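(* Let $q\ge 7$ be a prime power. Let $\mathcal{C}$ be the $[q-1,q-4,4]_q$ GRS code whose parity check matrix is obtained by removing any two columns from the $3\times(q+1)$ matrix $H_4$ whose columns are nonzero scalar multiples of $(1,t,t^2)^{tr}$, $t\in\mathbb{F}_q$, and of $(0,0,1)^{tr}$ (so $\mathcal{C}$ corresponds to the conic in $\mathrm{PG}(2,q)$ with two points removed). Put $n=q-1$. Then $\mathcal{C}$ has covering radius $3$, and the weight distributions of its cosets are as follows. There are $(q-1)^2$ cosets of weight $1$, all with weight distribution $D_1$. Moreover: (i) If $q$ is odd, the weight $2$ cosets are partitioned into three classes: $(q-1)\frac{q+1}{2}$ cosets with distribution $D_2\left(\frac{q-1}{2}\right)$, $(q-1)\frac{(q-1)(q+4)}{2}$ cosets with distribution $D_2\left(\frac{q-3}{2}\right)$, and $(q-1)\frac{(q-1)(q-3)}{2}$ cosets with distribution $D_2\left(\frac{q-5}{2}\right)$; there are $2(q-1)$ cosets of weight $3$, all with distribution $D_3$. (ii) If $q$ is even, the weight $2$ cosets are partitioned into two classes: $3(q-1)^2$ cosets with distribution $D_2\left(\frac{q-2}{2}\right)$ and $(q-1)^2(q-2)$ cosets with distribution $D_2\left(\frac{q-4}{2}\right)$; there are $3(q-1)$ cosets of weight $3$, all with distribution $D_3$. In both cases, for weight $2$ cosets $\mathcal{V}_a,\mathcal{V}_b$ in distinct classes, $$(-1)^{n}B_w(\mathcal{V}_a)-B_{n+2-w}(\mathcal{V}_a)=(-1)^{n}B_w(\mathcal{V}_b)-B_{n+2-w}(\mathcal{V}_b),\quad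 w=3,\ldots,n.$$
   Context: For an $[n,n-3,4]_q$ code $\mathcal{C}$ (linear, length $n$, dimension $n-3$, minimum distance $4$), a coset is a translate $\mathcal{C}+\mathbf{v}$; its weight is the smallest Hamming weight of a vector in it. The covering radius is the least $R$ such that every vector of $\mathbb{F}_q^n$ is within Hamming distance $R$ of a codeword. $A_w(\mathcal{C})$ (resp. $B_w(\mathcal{V})$) is the number of vectors of Hamming weight $w$ in $\mathcal{C}$ (resp. in the coset $\mathcal{V}$). Put $\Omega_w^{(v)}(n,4)=(-1)^{w-4}\binom{n-v}{w-v}\binom{w-1-v}{2-v}$. A coset $\mathcal{V}$ has weight distribution: - $D_1$ if $B_0=B_2=0$, $B_1=1$, $B_3=\binom{n-1}{3}$, and $B_w=A_w(\mathcal{C})-\Omega_w^{(0)}(n,4)+\Omega_w^{(1)}(n,4)$ for $w=4,\ldots,n$; - $D_2(i)$ if $B_0=B_1=0$, $B_2=i$, and $B_w=A_w(\mathcal{C})-\Omega_w^{(0)}(n,4)+(-1)^w\binom{n-2}{n-w}i$ for $w=3,\ldots,n$; - $D_3$ if $B_0=B_1=B_2=0$, $B_3=\binom n3$, and $B_w=A_w(\mathcal{C})-\Omega_w^{(0)}(n,4)$ for $w=4,\ldots,n$; where $B_w=B_w(\mathcal{V})$. *)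

theory Defs
  imports "HOL-Analysis.Analysis"
begin

definition hamming_weight :: "'a::zero ^ 'n \<Rightarrow> nat" where
  "hamming_weight x = card {i. x $ i \<noteq> 0}"

definition hamming_dist :: "'a ^ 'n \<Rightarrow> 'a ^ 'n \<Rightarrow> nat" where
  "hamming_dist x y = card {i. x $ i \<noteq> y $ i}"

text \<open>For a code with at least two codewords (otherwise \<^term>\<open>Min {}\<close> is unspecified).\<close>

definition min_distance :: "('a ^ 'n) set \<Rightarrow> nat" where
  "min_distance C = Min {hamming_dist x y | x y. x \<in> C \<and> y \<in> C \<and> x \<noteq> y}"

definition linear_code :: "nat \<Rightarrow> nat \<Rightarrow> nat \<Rightarrow> ('a::field ^ 'n) set \<Rightarrow> bool" where
  "linear_code n k d C \<longleftrightarrow>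
     CARD('n) = n \<and> vec.subspace C \<and> vec.dim C = k \<and> min_distance C = d"

definition code_of_parity_check :: "'a::field ^ 'n ^ 'm \<Rightarrow> ('a ^ 'n) set" where
  "code_of_parity_check H = {x. H *v x = 0}"

definition covering_radius :: "('a ^ 'n) set \<Rightarrow> nat" where
  "covering_radius C = (LEAST R. \<forall>v. \<exists>c\<in>C. hamming_dist v c \<le> R)"

definition code_cosets :: "('a::plus ^ 'n) set \<Rightarrow> ('a ^ 'n) set set" where
  "code_cosets C = range (\<lambda>v. (\<lambda>c. c + v) ` C)"

definition coset_weight :: "('a::zero ^ 'n) set \<Rightarrow> nat" where
  "coset_weight V = Min (hamming_weight ` V)"

definition cosets_of_weight :: "('a::{plus,zero} ^ 'n) set \<Rightarrow> nat \<Rightarrow> ('a ^ 'n) set set" where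
  "cosets_of_weight C w = {V \<in> code_cosets C. coset_weight V = w}"

text \<open>This is \<open>A\<^sub>w(C)\<close> when applied to a code and \<open>B\<^sub>w(V)\<close> when applied to a coset; it is
  integer-valued because the formulas below have signs.\<close>

definition num_weight :: "('a::zero ^ 'n) set \<Rightarrow> nat \<Rightarrow> int" where
  "num_weight V w = int (card {x \<in> V. hamming_weight x = w})"

text \<open>\<open>\<Omega>\<^sub>w\<^sup>(\<^sup>v\<^sup>)(n,4)\<close>. The sign \<open>(-1)\<^sup>w\<^sup>-\<^sup>4\<close> is written \<open>(-1)\<^sup>w\<close>, since \<open>w = 3\<close> occurs and
  truncated subtraction would give the wrong parity there. The remaining subtractions are only
  used for \<open>v \<le> 1\<close> and \<open>3 \<le> w \<le> n\<close>, where they do not truncate.\<close>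

definition Omega4 :: "nat \<Rightarrow> nat \<Rightarrow> nat \<Rightarrow> int" where
  "Omega4 v w n = (-1) ^ w * int ((n - v) choose (w - v)) * int ((w - 1 - v) choose (2 - v))"

definition distr_D1 :: "('a::zero ^ 'n) set \<Rightarrow> ('a ^ 'n) set \<Rightarrow> bool" where
  "distr_D1 C V \<longleftrightarrow> (let n = CARD('n) in
     num_weight V 0 = 0 \<and> num_weight V 2 = 0 \<and> num_weight V 1 = 1 \<and>
     num_weight V 3 = int ((n - 1) choose 3) \<and>
     (\<forall>w\<in>{4..n}. num_weight V w = num_weight C w - Omega4 0 w n + Omega4 1 w n))"

definition distr_D2 :: "nat \<Rightarrow> ('a::zero ^ 'n) set \<Rightarrow> ('a ^ 'n) set \<Rightarrow> bool" where
  "distr_D2 i C V \<longleftrightarrow> (let n = CARD('n) in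
     num_weight V 0 = 0 \<and> num_weight V 1 = 0 \<and> num_weight V 2 = int i \<and>
     (\<forall>w\<in>{3..n}. num_weight V w =
        num_weight C w - Omega4 0 w n + (-1) ^ w * int ((n - 2) choose (n - w)) * int i))"

definition distr_D3 :: "('a::zero ^ 'n) set \<Rightarrow> ('a ^ 'n) set \<Rightarrow> bool" where
  "distr_D3 C V \<longleftrightarrow> (let n = CARD('n) in
     num_weight V 0 = 0 \<and> num_weight V 1 = 0 \<and> num_weight V 2 = 0 \<and>
     num_weight V 3 = int (n choose 3) \<and>
     (\<forall>w\<in>{4..n}. num_weight V w = num_weight C w - Omega4 0 w n))"

definition D2_class :: "('a::{plus,zero} ^ 'n) set \<Rightarrow> nat \<Rightarrow> ('a ^ 'n) set set" where
  "D2_class C i = {V \<in> cosets_of_weight C 2. distr_D2 i C V}"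

fun conic_point :: "'q::field option \<Rightarrow> 'q ^ 3" where
  "conic_point (Some t) = vector [1, t, t\<^sup>2]"
| "conic_point None = vector [0, 0, 1]"

text \<open>The matrix \<open>H\<^sub>4\<close>. Its columns are indexed by the projective line, \<^term>\<open>None\<close> being the
  point at infinity, and \<open>s P\<close> is the scalar by which the column of \<open>P\<close> is multiplied.\<close>

definition conic_matrix :: "('q option \<Rightarrow> 'q) \<Rightarrow> 'q::{field,finite} ^ ('q option) ^ 3" where
  "conic_matrix s = (\<chi> i P. s P * conic_point P $ i)"

definition select_columns :: "('n \<Rightarrow> 'm) \<Rightarrow> 'a ^ 'm ^ 'k \<Rightarrow> 'a ^ 'n ^ 'k" where
  "select_columns \<sigma> H = (\<chi> i j. H $ i $ \<sigma> j)"

end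

theory Submission
  imports Defs
begin

text \<open>
  A coset is determined by its syndrome \<open>y\<close>. Any three columns of the parity check matrix form a
  basis, so the number of vectors of the coset supported in a set of at least three coordinates does
  not depend on \<open>y\<close>. Binomial inversion then expresses \<open>B\<^sub>w - A\<^sub>w\<close> through \<open>B\<^sub>0\<close>, \<open>B\<^sub>1\<close>, \<open>B\<^sub>2\<close>,
  and only \<open>B\<^sub>2\<close>, the number of chords of the punctured conic through \<open>y\<close>, remains to be found.

  A change of coordinates moves the two removed points to \<open>0\<close> and \<open>\<infinity>\<close>, so the columns become
  multiples of \<open>(1, t, t\<^sup>2)\<close> with \<open>t \<noteq> 0\<close>. For \<open>y\<close> off the punctured conic, \<open>2 B\<^sub>2\<close> is \<open>q - 1\<close> minus
  the number of \<open>t \<noteq> 0\<close> whose line to \<open>y\<close> is a tangent or passes through a removed point. These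
  \<open>t\<close> are the roots of two linear equations and a quadratic one, whose number depends on which of
  the coordinates of \<open>y\<close> vanish and on whether \<open>y\<^sub>1\<^sup>2 - y\<^sub>0 y\<^sub>2\<close> is a square. The sizes of the extreme
  classes are counted directly; that of the remaining class follows by subtraction from \<open>q\<^sup>3\<close>.
\<close>

section \<open>Coset weight distributions of codes with three independent parity checks\<close>

definition supp :: "'a::zero ^ 'n \<Rightarrow> 'n set" where
  "supp x = {i. x $ i \<noteq> 0}"

lemma hamming_weight_eq_card_supp: "hamming_weight x = card (supp x)"
  by (simp add: hamming_weight_def supp_def)

lemma hamming_weight_eq_0_iff [simp]:
  "hamming_weight (x :: 'a::zero ^ 'n::finite) = 0 \<longleftrightarrow> x = 0"
  by (auto simp: hamming_weight_def vec_eq_iff)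

lemma hamming_weight_0 [simp]: "hamming_weight (0 :: 'a::zero ^ 'n) = 0"
  by (simp add: hamming_weight_def)

lemma supp_diff_subset: "supp (x - y :: 'a::ab_group_add ^ 'n) \<subseteq> supp x \<union> supp y"
  by (auto simp: supp_def)

lemma supp_add_subset: "supp (x + y :: 'a::ab_group_add ^ 'n) \<subseteq> supp x \<union> supp y"
  by (auto simp: supp_def)

lemma hamming_weight_diff_le:
  "hamming_weight (x - y :: 'a::ab_group_add ^ 'n::finite) \<le> hamming_weight x + hamming_weight y"
  unfolding hamming_weight_eq_card_supp
  by (rule order_trans[OF card_mono[OF _ supp_diff_subset] card_Un_le]) simp

lemma hamming_dist_eq_weight:
  "hamming_dist x (y :: 'a::ab_group_add ^ 'n) = hamming_weight (x - y)"
  by (simp add: hamming_dist_def hamming_weight_def)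

section \<open>Double counting and binomial inversion\<close>

lemma card_supersets_of_card:
  fixes A :: "'n::finite set"
  assumes "card A \<le> t"
  shows "card {S. card S = t \<and> A \<subseteq> S} = (CARD('n) - card A) choose (t - card A)"
proof -
  have "bij_betw (\<lambda>S. S - A) {S. card S = t \<and> A \<subseteq> S} {T. T \<subseteq> - A \<and> card T = t - card A}"
  proof (rule bij_betw_byWitness[where f' = "\<lambda>T. T \<union> A"])
    show "(\<lambda>T. T \<union> A) ` {T. T \<subseteq> - A \<and> card T = t - card A} \<subseteq> {S. card S = t \<and> A \<subseteq> S}"
      using assms by (auto simp: card_Un_disjoint disjoint_eq_subset_Compl)
    show "(\<lambda>S. S - A) ` {S. card S = t \<and> A \<subseteq> S} \<subseteq> {T. T \<subseteq> - A \<and> card T = t - card A}"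
      by (auto simp: card_Diff_subset)
  qed auto
  then have "card {S. card S = t \<and> A \<subseteq> S} = card {T. T \<subseteq> - A \<and> card T = t - card A}"
    by (rule bij_betw_same_card)
  also have "\<dots> = card (- A) choose (t - card A)"
    by (rule n_subsets) simp
  finally show ?thesis
    by (simp add: Compl_eq_Diff_UNIV card_Diff_subset)
qed

text \<open>Counts the pairs of a vector \<open>x\<close> and a set \<open>S\<close> containing its
  support in two ways: with \<open>n\<close> the length, a vector of weight \<open>j \<le> t\<close>
  has its support in \<open>(n - j) choose (t - j)\<close> sets of size \<open>t\<close>.\<close>

lemma sum_card_supported:
  fixes V :: "('a::{zero,finite} ^ 'n::finite) set"
  shows "(\<Sum>S | card S = t. int (card {x \<in> V. supp x \<subseteq> S}))
    = (\<Sum>j\<le>t. int ((CARD('n) - j) choose (t - j)) * num_weight V j)"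
proof -
  have "(\<Sum>S | card S = t. int (card {x \<in> V. supp x \<subseteq> S}))
      = (\<Sum>S | card S = t. \<Sum>x\<in>V. if supp x \<subseteq> S then 1 else 0)"
    by (intro sum.cong refl) (simp flip: sum.inter_filter)
  also have "\<dots> = (\<Sum>x\<in>V. \<Sum>S | card S = t. if supp x \<subseteq> S then 1 else 0)"
    by (rule sum.swap)
  also have "\<dots> = (\<Sum>x\<in>V. int (card {S. card S = t \<and> supp x \<subseteq> S}))"
    by (intro sum.cong refl) (simp flip: sum.inter_filter)
  also have "\<dots> = (\<Sum>x\<in>V. \<Sum>j\<le>t. if hamming_weight x = j
      then int ((CARD('n) - j) choose (t - j)) else 0)"
  proof (intro sum.cong refl)
    fix x :: "'a ^ 'n"
    show "int (card {S. card S = t \<and> supp x \<subseteq> S}) = (\<Sum>j\<le>t. if hamming_weight x = j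
      then int ((CARD('n) - j) choose (t - j)) else 0)"
    proof (cases "hamming_weight x \<le> t")
      case True
      then show ?thesis
        by (simp add: card_supersets_of_card hamming_weight_eq_card_supp)
    next
      case False
      then have "{S. card S = t \<and> supp x \<subseteq> S} = {}"
        by (auto simp: hamming_weight_eq_card_supp dest!: card_mono[rotated])
      with False show ?thesis
        by simp
    qed
  qed
  also have "\<dots> = (\<Sum>j\<le>t. \<Sum>x\<in>V. if hamming_weight x = j
      then int ((CARD('n) - j) choose (t - j)) else 0)"
    by (rule sum.swap)
  also have "\<dots> = (\<Sum>j\<le>t. int ((CARD('n) - j) choose (t - j)) * num_weight V j)"
    by (intro sum.cong refl) (simp add: num_weight_def flip: sum.inter_filter)
  finally show ?thesis .
qed

text \<open>The two binomials regroup into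
  \<open>((n - j) choose (w - j)) * ((w - j) choose (w - t))\<close>. The first factor is constant,
  and the alternating row sum of the second vanishes unless \<open>j = w\<close>.\<close>

lemma alternating_binomial_product_sum:
  assumes "j \<le> w" "w \<le> n"
  shows "(\<Sum>t=j..w. (-1) ^ (w - t) * int ((n - t) choose (w - t)) * int ((n - j) choose (t - j)))
    = (if j = w then 1 else 0)"
proof -
  have "(\<Sum>t=j..w. (-1) ^ (w - t) * int ((n - t) choose (w - t)) * int ((n - j) choose (t - j)))
      = (\<Sum>t=j..w. int ((n - j) choose (w - j)) * ((-1) ^ (w - t) * int ((w - j) choose (w - t))))"
  proof (intro sum.cong refl)
    fix t assume t: "t \<in> {j..w}"
    then have "w - j - (t - j) = w - t" "n - j - (t - j) = n - t"
      by auto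
    with t have "((n - j) choose (w - j)) * ((w - j) choose (t - j))
        = ((n - j) choose (t - j)) * ((n - t) choose (w - t))"
      using choose_mult[of "t - j" "w - j" "n - j"] assms by (auto intro: diff_le_mono)
    moreover have "(w - j) choose (t - j) = (w - j) choose (w - t)"
      using t binomial_symmetric[of "t - j" "w - j"] by (auto intro: diff_le_mono)
    ultimately have "int ((n - j) choose (w - j)) * int ((w - j) choose (w - t))
        = int ((n - j) choose (t - j)) * int ((n - t) choose (w - t))"
      by (metis of_nat_mult)
    then show "(-1) ^ (w - t) * int ((n - t) choose (w - t)) * int ((n - j) choose (t - j))
        = int ((n - j) choose (w - j)) * ((-1) ^ (w - t) * int ((w - j) choose (w - t)))"
      by (simp add: mult.left_commute mult.commute)
  qed
  also have "\<dots> = int ((n - j) choose (w - j)) *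
      (\<Sum>i\<le>w - j. (-1) ^ i * int ((w - j) choose i))"
    unfolding sum_distrib_left
    by (rule sum.reindex_bij_witness[where i = "\<lambda>i. w - i" and j = "\<lambda>t. w - t"])
       (use assms in auto)
  also have "\<dots> = (if j = w then 1 else 0)"
    using choose_alternating_sum[of "w - j", where 'a = int] assms by auto
  finally show ?thesis .
qed

lemma binomial_transform_inverse:
  fixes B :: "nat \<Rightarrow> int"
  assumes "w \<le> n"
  shows "(\<Sum>t\<le>w. (-1) ^ (w - t) * int ((n - t) choose (w - t)) *
      (\<Sum>j\<le>t. int ((n - j) choose (t - j)) * B j)) = B w"
proof -
  let ?c = "\<lambda>t. (-1) ^ (w - t) * int ((n - t) choose (w - t))"
  have "(\<Sum>t\<le>w. ?c t * (\<Sum>j\<le>t. int ((n - j) choose (t - j)) * B j))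
      = (\<Sum>t\<le>w. \<Sum>j\<le>t. ?c t * int ((n - j) choose (t - j)) * B j)"
    by (simp add: sum_distrib_left mult.assoc)
  also have "\<dots> = (\<Sum>j\<le>w. \<Sum>t=j..w. ?c t * int ((n - j) choose (t - j)) * B j)"
    unfolding sum.Sigma[OF finite_atMost ballI[OF finite_atMost]]
      sum.Sigma[OF finite_atMost ballI[OF finite_atLeastAtMost]]
    by (rule sum.reindex_bij_witness[where i = "\<lambda>(j, t). (t, j)" and j = "\<lambda>(t, j). (j, t)"]) auto
  also have "\<dots> = (\<Sum>j\<le>w. (if j = w then 1 else 0) * B j)"
    using assms by (intro sum.cong refl)
      (simp only: sum_distrib_right[symmetric] alternating_binomial_product_sum atMost_iff)
  also have "\<dots> = (\<Sum>j\<le>w. if j = w then B j else 0)"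
    by (intro sum.cong) auto
  finally show ?thesis
    by simp
qed

text \<open>Brings \<open>Omega4\<close> into the shape that inversion produces: this is the
  coefficient of \<open>d 0\<close> in \<open>num_weight_coset_diff\<close>, and
  \<open>Omega4_1_eq\<close> gives that of \<open>d 1\<close>.\<close>

lemma Omega4_0_eq:
  assumes "3 \<le> w" "w \<le> n"
  shows "Omega4 0 w n = (-1) ^ w * (int (n choose w) - int n * int ((n - 1) choose (w - 1))
    + int (n choose 2) * int ((n - 2) choose (w - 2)))"
proof -
  have "int n * int ((n - 1) choose (w - 1)) = int w * int (n choose w)"
    using times_binomial_minus1_eq[of w n] assms by (simp flip: of_nat_mult)
  moreover have "int (n choose 2) * int ((n - 2) choose (w - 2)) = int (n choose w) * int (w choose 2)"
    using choose_mult[of 2 w n] assms by (simp flip: of_nat_mult)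
  moreover have "int ((w - 1) choose 2) = 1 - int w + int (w choose 2)"
    using choose_reduce_nat[of w 2] assms by (simp add: numeral_2_eq_2)
  moreover have "Omega4 0 w n = (-1) ^ w * (int (n choose w) * int ((w - 1) choose 2))"
    by (simp add: Omega4_def)
  ultimately show ?thesis
    by (simp only:) (simp add: algebra_simps)
qed

lemma Omega4_1_eq:
  assumes "3 \<le> w" "w \<le> n"
  shows "Omega4 1 w n = (-1) ^ w * (int (n - 1) * int ((n - 2) choose (w - 2))
    - int ((n - 1) choose (w - 1)))"
proof -
  have "(n - 1) * ((n - 2) choose (w - 2)) = (w - 1) * ((n - 1) choose (w - 1))"
    using times_binomial_minus1_eq[of "w - 1" "n - 1"] assms by (simp add: numeral_2_eq_2)
  then have "int (n - 1) * int ((n - 2) choose (w - 2)) = int (w - 1) * int ((n - 1) choose (w - 1))"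
    by (simp only: of_nat_mult[symmetric])
  moreover have "int ((w - 1 - 1) choose (2 - 1)) = int (w - 1) - 1"
    using assms by simp
  moreover have "Omega4 1 w n =
      (-1) ^ w * (int ((n - 1) choose (w - 1)) * int ((w - 1 - 1) choose (2 - 1)))"
    by (simp add: Omega4_def)
  ultimately show ?thesis
    by (simp only:) (simp add: algebra_simps)
qed

section \<open>Cosets of a code given by a syndrome map\<close>

text \<open>\<open>syn_eq_0\<close> and \<open>syn_onto\<close> say that any three columns of the
  parity check matrix are independent and span. The syndromes form only an abelian group, so that
  triples can serve as syndromes; hence \<open>syn_scale\<close> speaks of the kernel alone.\<close>

locale mds_syndrome =
  fixes syn :: "'q::{field,finite} ^ 'n::finite \<Rightarrow> 's::ab_group_add"
  assumes syn_add: "syn (x + y) = syn x + syn y"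
    and syn_eq_0: "hamming_weight x \<le> 3 \<Longrightarrow> syn x = 0 \<Longrightarrow> x = 0"
    and syn_onto: "card S = 3 \<Longrightarrow> \<exists>x. supp x \<subseteq> S \<and> syn x = z"
    and syn_scale: "syn x = 0 \<Longrightarrow> syn (c *s x) = 0"
    and CARD_ge_4: "CARD('n) \<ge> 4"
begin

definition coset :: "'s \<Rightarrow> ('q ^ 'n) set" where
  "coset y = {x. syn x = y}"

lemma syn_0 [simp]: "syn 0 = 0"
  using syn_add[of 0 0] by simp

lemma syn_diff: "syn (x - y) = syn x - syn y"
  using syn_add[of "x - y" y] by (simp add: algebra_simps)

lemma syn_light: "\<exists>x. hamming_weight x \<le> 3 \<and> syn x = y"
proof -
  obtain S :: "'n set" where S: "card S = 3"
    using obtain_subset_with_card_n[of 3 "UNIV :: 'n set"] CARD_ge_4 by auto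
  then obtain x where "supp x \<subseteq> S" "syn x = y"
    using syn_onto by blast
  with S show ?thesis
    by (metis hamming_weight_eq_card_supp card_mono finite)
qed

lemma inj_coset: "inj coset"
proof (rule injI)
  fix y z assume "coset y = coset z"
  moreover obtain x where "syn x = y"
    using syn_light by blast
  ultimately show "y = z"
    by (auto simp: coset_def)
qed

lemma coset_translate: "(\<lambda>c. c + v) ` coset y = coset (y + syn v)"
proof (intro set_eqI iffI)
  fix x assume "x \<in> coset (y + syn v)"
  then have "x - v \<in> coset y"
    by (simp add: coset_def syn_diff)
  then show "x \<in> (\<lambda>c. c + v) ` coset y"
    by (intro image_eqI[of _ _ "x - v"]) auto
qed (auto simp: coset_def syn_add)

lemma code_cosets_eq: "code_cosets (coset 0) = range coset"
proof -
  have "range (\<lambda>v. coset (syn v)) = range coset"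
    using syn_light by (metis image_image surjI surj_def)
  then show ?thesis
    by (simp add: code_cosets_def coset_translate)
qed

text \<open>Some vector of syndrome \<open>y\<close> is supported on three coordinates of
  \<open>S\<close>; subtracting it matches the two sets.\<close>

lemma card_supported_coset:
  assumes "card S \<ge> 3"
  shows "card {x \<in> coset y. supp x \<subseteq> S} = card {x \<in> coset 0. supp x \<subseteq> S}"
proof -
  obtain T where "T \<subseteq> S" "card T = 3"
    using obtain_subset_with_card_n[OF assms] by auto
  then obtain v where v: "supp v \<subseteq> S" "syn v = y"
    using syn_onto by (metis order_trans)
  have "bij_betw (\<lambda>x. x - v) {x \<in> coset y. supp x \<subseteq> S} {x \<in> coset 0. supp x \<subseteq> S}"
  proof (rule bij_betw_byWitness[where f' = "\<lambda>x. x + v"])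
    show "(\<lambda>x. x - v) ` {x \<in> coset y. supp x \<subseteq> S} \<subseteq> {x \<in> coset 0. supp x \<subseteq> S}"
      using v supp_diff_subset by (fastforce simp: coset_def syn_diff)
    show "(\<lambda>x. x + v) ` {x \<in> coset 0. supp x \<subseteq> S} \<subseteq> {x \<in> coset y. supp x \<subseteq> S}"
      using v supp_add_subset by (fastforce simp: coset_def syn_add)
  qed auto
  then show ?thesis
    by (rule bij_betw_same_card)
qed

text \<open>The transform \<open>e t\<close> of \<open>d\<close> compares the numbers of vectors
  supported in sets of size \<open>t\<close>, so it vanishes for \<open>t \<ge> 3\<close>. Inversion
  then expresses \<open>d w\<close> through \<open>d 0\<close>, \<open>d 1\<close> and
  \<open>d 2\<close>.\<close>

lemma num_weight_coset_diff:
  assumes "3 \<le> w" "w \<le> CARD('n)" and n: "n = CARD('n)"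
    and d: "\<And>j. d j = num_weight (coset y) j - num_weight (coset 0) j"
  shows "d w = (-1) ^ w * (int (n choose w) * d 0
      - int ((n - 1) choose (w - 1)) * (int n * d 0 + d 1)
      + int ((n - 2) choose (w - 2)) * (int (n choose 2) * d 0 + int (n - 1) * d 1 + d 2))"
proof -
  define e where "e t = (\<Sum>j\<le>t. int ((n - j) choose (t - j)) * d j)" for t
  have e_eq: "e t = (\<Sum>S | card S = t. int (card {x \<in> coset y. supp x \<subseteq> S}))
      - (\<Sum>S | card S = t. int (card {x \<in> coset 0. supp x \<subseteq> S}))" for t
    by (simp add: e_def n d sum_card_supported right_diff_distrib sum_subtractf)
  have e_0: "e t = 0" if "t \<ge> 3" for t
    unfolding e_eq using that by (simp add: card_supported_coset[of _ y])
  have "d w = (\<Sum>t\<le>w. (-1) ^ (w - t) * int ((n - t) choose (w - t)) * e t)"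
    unfolding e_def using binomial_transform_inverse[of w n d] assms(2) n by simp
  also have "\<dots> = (\<Sum>t\<in>{0, 1, 2}. (-1) ^ (w - t) * int ((n - t) choose (w - t)) * e t)"
    by (rule sum.mono_neutral_right) (use assms(1) in \<open>auto intro: e_0\<close>)
  also have "\<dots> = (-1) ^ w * (int (n choose w) * e 0 - int ((n - 1) choose (w - 1)) * e 1
      + int ((n - 2) choose (w - 2)) * e 2)"
    using assms(1) by (auto dest!: le_Suc_ex simp: numeral_3_eq_3 numeral_2_eq_2 algebra_simps)
  finally show ?thesis
    by (simp add: e_def numeral_2_eq_2 algebra_simps)
qed

lemma syn_light_unique:
  assumes "syn x = syn x'" "hamming_weight x + hamming_weight x' \<le> 3"
  shows "x = x'"
  using syn_eq_0[of "x - x'"] hamming_weight_diff_le[of x x'] assms by (simp add: syn_diff)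

lemma num_weight_coset_eq_0_iff:
  "num_weight (coset y) w = 0 \<longleftrightarrow> (\<forall>x. syn x = y \<longrightarrow> hamming_weight x \<noteq> w)"
  by (auto simp: num_weight_def coset_def)

lemma num_weight_coset_0: "num_weight (coset y) 0 = (if y = 0 then 1 else 0)"
proof -
  have "{x \<in> coset y. hamming_weight x = 0} = (if y = 0 then {0} else {})"
    by (auto simp: coset_def)
  then show ?thesis
    by (simp add: num_weight_def)
qed

lemma num_weight_code:
  assumes "1 \<le> w" "w \<le> 3"
  shows "num_weight (coset 0) w = 0"
  unfolding num_weight_coset_eq_0_iff using syn_eq_0 assms
  by (metis hamming_weight_eq_0_iff not_one_le_zero)

text \<open>For \<open>y \<noteq> 0\<close> the differences are \<open>d 0 = -1\<close> and, since
  the code has no words of weight 1 or 2, \<open>d 1\<close> and \<open>d 2\<close> are the counts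
  of the coset itself. The three distributions are the cases \<open>(1, 0)\<close>,
  \<open>(0, i)\<close> and \<open>(0, 0)\<close> of these two counts.\<close>

lemma num_weight_coset:
  assumes "y \<noteq> 0" "3 \<le> w" "w \<le> CARD('n)" "n = CARD('n)"
  shows "num_weight (coset y) w = num_weight (coset 0) w - Omega4 0 w n
    + Omega4 1 w n * num_weight (coset y) 1
    + (-1) ^ w * int ((n - 2) choose (n - w)) * num_weight (coset y) 2"
proof -
  \<comment> \<open>The distribution \<open>D2\<close> is stated with
    \<open>(n - 2) choose (n - w)\<close>, while inversion yields
    \<open>(n - 2) choose (w - 2)\<close>.\<close>
  have "n - 2 - (n - w) = w - 2"
    using assms by arith
  then have "(n - 2) choose (n - w) = (n - 2) choose (w - 2)"
    using binomial_symmetric[of "n - w" "n - 2"] assms by simp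
  moreover define d where "d j = num_weight (coset y) j - num_weight (coset 0) j" for j
  have d: "d 0 = -1" "d 1 = num_weight (coset y) 1" "d 2 = num_weight (coset y) 2"
    using assms(1) num_weight_code[of 1] num_weight_code[of 2]
    by (simp_all add: d_def num_weight_coset_0)
  have "w \<le> n"
    using assms by simp
  moreover have "d w = (-1) ^ w * (- int (n choose w)
      - int ((n - 1) choose (w - 1)) * (- int n + num_weight (coset y) 1)
      + int ((n - 2) choose (w - 2)) * (- int (n choose 2)
        + int (n - 1) * num_weight (coset y) 1 + num_weight (coset y) 2))"
    using num_weight_coset_diff[OF assms(2-4) d_def] unfolding d by simp
  ultimately show ?thesis
    unfolding d_def by (simp only: Omega4_0_eq[OF assms(2)] Omega4_1_eq[OF assms(2)])
      (simp add: algebra_simps)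
qed

lemma coset_weight_eq_iff:
  "coset_weight (coset y) = w \<longleftrightarrow>
    num_weight (coset y) w \<noteq> 0 \<and> (\<forall>j<w. num_weight (coset y) j = 0)"
proof -
  have "coset y \<noteq> {}"
    using syn_light by (auto simp: coset_def)
  then show ?thesis
    unfolding coset_weight_def num_weight_coset_eq_0_iff
    by (subst Min_eq_iff) (auto simp: coset_def not_less[symmetric])
qed

lemma coset_weight_le: "coset_weight (coset (syn x)) \<le> hamming_weight x"
  unfolding coset_weight_def by (rule Min_le) (auto simp: coset_def)

lemma coset_weight_le_3: "coset_weight (coset y) \<le> 3"
  using coset_weight_le syn_light by (metis order_trans)

lemma coset_weight_eq_0_iff: "coset_weight (coset y) = 0 \<longleftrightarrow> y = 0"
  by (simp add: coset_weight_eq_iff num_weight_coset_0)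

lemma cosets_of_weight_eq:
  "cosets_of_weight (coset 0) w = coset ` {y. coset_weight (coset y) = w}"
  by (auto simp: cosets_of_weight_def code_cosets_eq)

lemma card_cosets_of_weight:
  "card (cosets_of_weight (coset 0) w) = card {y. coset_weight (coset y) = w}"
  unfolding cosets_of_weight_eq by (intro card_image inj_on_subset[OF inj_coset]) simp

lemma coset_weight_1_iff: "coset_weight (coset y) = 1 \<longleftrightarrow> (\<exists>x. hamming_weight x = 1 \<and> syn x = y)"
proof -
  have "y \<noteq> 0" if "hamming_weight x = 1" "syn x = y" for x
    using syn_eq_0[of x] that by auto
  then show ?thesis
    by (auto simp: coset_weight_eq_iff num_weight_coset_0 num_weight_coset_eq_0_iff)
qed

text \<open>Two vectors of a coset whose weights add up to at most 3 are equal, as the minimum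
  distance exceeds 3. So the vector of weight 1 is unique and excludes vectors of weight 2.\<close>

lemma distr_D1_coset:
  assumes "coset_weight (coset y) = 1"
  shows "distr_D1 (coset 0) (coset y)"
proof -
  from assms obtain x where x: "hamming_weight x = 1" "syn x = y"
    using coset_weight_1_iff by blast
  have y: "y \<noteq> 0"
    using assms coset_weight_eq_0_iff[of y] by auto
  have "{x \<in> coset y. hamming_weight x = 1} = {x}"
    using x syn_light_unique by (auto simp: coset_def)
  then have 1: "num_weight (coset y) 1 = 1"
    by (simp add: num_weight_def)
  have 2: "num_weight (coset y) 2 = 0"
    unfolding num_weight_coset_eq_0_iff
  proof (intro allI impI notI)
    fix x' assume "syn x' = y" "hamming_weight x' = 2"
    with x have "x = x'"
      by (intro syn_light_unique) auto
    with x \<open>hamming_weight x' = 2\<close> show False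
      by simp
  qed
  \<comment> \<open>The general formula gives \<open>(n choose 3) - ((n - 1) choose 2)\<close>,
    which Pascal's rule simplifies.\<close>
  have "num_weight (coset y) 3 = int ((CARD('n) - 1) choose 3)"
    using num_weight_coset[of y 3 "CARD('n)"] y CARD_ge_4 num_weight_code[of 3] 1 2
      choose_reduce_nat[of "CARD('n)" 3]
    by (simp add: Omega4_def numeral_2_eq_2 numeral_3_eq_3)
  then show ?thesis
    using y 1 2 by (simp add: distr_D1_def Let_def num_weight_coset_0 num_weight_coset[of y])
qed

lemma distr_D2_coset_iff:
  assumes "coset_weight (coset y) = 2"
  shows "distr_D2 i (coset 0) (coset y) \<longleftrightarrow> num_weight (coset y) 2 = int i"
proof -
  have "y \<noteq> 0"
    using assms coset_weight_eq_0_iff[of y] by auto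
  moreover have "num_weight (coset y) 1 = 0"
    using assms by (simp add: coset_weight_eq_iff)
  ultimately show ?thesis
    by (auto simp: distr_D2_def Let_def num_weight_coset_0 num_weight_coset[of y])
qed

lemma distr_D3_coset:
  assumes "coset_weight (coset y) = 3"
  shows "distr_D3 (coset 0) (coset y)"
proof -
  have y: "y \<noteq> 0"
    using assms coset_weight_eq_0_iff[of y] by auto
  have 12: "num_weight (coset y) 1 = 0" "num_weight (coset y) 2 = 0"
    using assms by (simp_all add: coset_weight_eq_iff)
  moreover have "num_weight (coset y) 3 = int (CARD('n) choose 3)"
    using num_weight_coset[of y 3 "CARD('n)"] y CARD_ge_4 num_weight_code[of 3] 12
    by (simp add: Omega4_def)
  ultimately show ?thesis
    using y by (simp add: distr_D3_def Let_def num_weight_coset_0 num_weight_coset[of y])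
qed

lemma D2_class_eq:
  "D2_class (coset 0) i =
    coset ` {y. coset_weight (coset y) = 2 \<and> num_weight (coset y) 2 = int i}"
  by (auto simp: D2_class_def cosets_of_weight_eq distr_D2_coset_iff)

lemma card_D2_class:
  "card (D2_class (coset 0) i) =
    card {y. coset_weight (coset y) = 2 \<and> num_weight (coset y) 2 = int i}"
  unfolding D2_class_eq by (intro card_image inj_on_subset[OF inj_coset]) simp

text \<open>The distance from \<open>v\<close> to the code is the weight of the coset of
  \<open>v\<close>. It never exceeds 3, and the assumed coset attains 3.\<close>

lemma covering_radius_code:
  assumes "coset_weight (coset y) = 3"
  shows "covering_radius (coset 0) = 3"
  unfolding covering_radius_def
proof (rule Least_equality)
  show "\<forall>v. \<exists>c\<in>coset 0. hamming_dist v c \<le> 3"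
  proof
    fix v
    obtain x where "hamming_weight x \<le> 3" "syn x = syn v"
      using syn_light by blast
    then show "\<exists>c\<in>coset 0. hamming_dist v c \<le> 3"
      by (intro bexI[of _ "v - x"]) (auto simp: coset_def syn_diff hamming_dist_eq_weight)
  qed
next
  fix R assume R: "\<forall>v. \<exists>c\<in>coset 0. hamming_dist v c \<le> R"
  obtain v where v: "syn v = y"
    using syn_light by blast
  obtain c where c: "syn c = 0" "hamming_weight (v - c) \<le> R"
    using R by (auto simp: coset_def hamming_dist_eq_weight)
  then show "3 \<le> R"
    using coset_weight_le[of "v - c"] v assms by (simp add: syn_diff)
qed

lemma subspace_code: "vec.subspace (coset 0)"
  by (auto simp: vec.subspace_def coset_def syn_add syn_scale)

lemma min_distance_code: "min_distance (coset 0) = 4"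
  unfolding min_distance_def
proof (rule Min_eqI)
  have ge: "4 \<le> hamming_weight z" if "syn z = 0" "z \<noteq> 0" for z
    using syn_eq_0[of z] that by force
  show "4 \<le> d" if "d \<in> {hamming_dist x y |x y. x \<in> coset 0 \<and> y \<in> coset 0 \<and> x \<noteq> y}" for d
    using that by (auto simp: hamming_dist_eq_weight coset_def syn_diff intro!: ge)
  obtain S :: "'n set" where S: "card S = 4"
    using obtain_subset_with_card_n[OF CARD_ge_4] by auto
  then obtain a where a: "a \<in> S"
    by fastforce
  then have "card (S - {a}) = 3"
    using S by simp
  \<comment> \<open>The column at \<open>a\<close> is a combination of the other three columns in
    \<open>S\<close>; this dependency is a codeword of weight at most 4, nonzero because its entry
    at \<open>a\<close> is 1.\<close>
  then obtain x where x: "supp x \<subseteq> S - {a}" "syn x = syn (axis a 1)"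
    using syn_onto by blast
  define z where "z = axis a 1 - x"
  have "x $ a = 0"
    using x by (auto simp: supp_def)
  then have "z $ a \<noteq> 0"
    by (simp add: z_def)
  then have z: "z \<noteq> 0" "syn z = 0"
    using x by (auto simp: z_def syn_diff)
  have "supp z \<subseteq> S"
    using x a by (auto simp: z_def supp_def axis_def split: if_splits)
  then have "hamming_weight z \<le> 4"
    using S by (metis hamming_weight_eq_card_supp card_mono finite)
  with ge[OF z(2,1)] have "hamming_dist z 0 = 4"
    by (simp add: hamming_dist_eq_weight)
  then show "4 \<in> {hamming_dist x y |x y. x \<in> coset 0 \<and> y \<in> coset 0 \<and> x \<noteq> y}"
    using z by (intro CollectI exI[of _ z] exI[of _ 0]) (simp add: coset_def)
  show "finite {hamming_dist x y |x y. x \<in> coset 0 \<and> y \<in> coset 0 \<and> x \<noteq> y}"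
    by (rule finite_subset[of _ "range (\<lambda>(x, y). hamming_dist x y)"]) auto
qed

text \<open>Adjoining three unit vectors to the code raises the dimension by one each time and
  exhausts the whole space.\<close>
lemma dim_code: "vec.dim (coset 0) = CARD('n) - 3"
proof -
  obtain S :: "'n set" where S: "card S = 3"
    using obtain_subset_with_card_n[of 3 "UNIV :: 'n set"] CARD_ge_4 by auto
  then obtain i j k where ijk: "S = {i, j, k}" "i \<noteq> j" "i \<noteq> k" "j \<noteq> k"
    by (auto simp: card_3_iff)
  let ?e = "\<lambda>i. axis i (1::'q)"
  have span_C: "vec.span (coset 0) = coset 0"
    by (rule vec.span_eq_iff[THEN iffD2, OF subspace_code])
  \<comment> \<open>A membership of one of the unit vectors in the preceding span would give a
    nonzero codeword supported in \<open>S\<close>.\<close>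
  have light: "z = 0" if "z \<in> coset 0" "supp z \<subseteq> S" for z
    using that S syn_eq_0[of z] card_mono[OF _ that(2)]
    by (simp add: coset_def hamming_weight_eq_card_supp)
  have span3: "x \<in> vec.span (insert (?e k) (insert (?e j) (insert (?e i) (coset 0))))
      \<longleftrightarrow> (\<exists>c b a. x - c *s ?e k - b *s ?e j - a *s ?e i \<in> coset 0)" for x
    by (simp add: vec.span_insert span_C)
  have "x \<in> vec.span (insert (?e k) (insert (?e j) (insert (?e i) (coset 0))))" for x
  proof -
    obtain v where v: "supp v \<subseteq> S" "syn v = syn x"
      using syn_onto[OF S] by blast
    have "v = v $ k *s ?e k + v $ j *s ?e j + v $ i *s ?e i"
      using v(1) ijk by (auto simp: vec_eq_iff axis_def supp_def)
    then have "x - v $ k *s ?e k - v $ j *s ?e j - v $ i *s ?e i = x - v"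
      by (metis diff_diff_add)
    also have "\<dots> \<in> coset 0"
      using v(2) by (simp add: coset_def syn_diff)
    finally show ?thesis
      unfolding span3 by blast
  qed
  then have "vec.span (insert (?e k) (insert (?e j) (insert (?e i) (coset 0)))) = UNIV"
    by blast
  then have "vec.dim (insert (?e k) (insert (?e j) (insert (?e i) (coset 0)))) = CARD('n)"
    by (metis vec.dim_span vec_dim_card)
  moreover have "?e i \<notin> vec.span (coset 0)"
  proof
    assume "?e i \<in> vec.span (coset 0)"
    then have "?e i = 0"
      by (intro light) (auto simp: span_C supp_def ijk axis_def)
    then show False
      by simp
  qed
  moreover have "?e j \<notin> vec.span (insert (?e i) (coset 0))"
  proof
    assume "?e j \<in> vec.span (insert (?e i) (coset 0))"
    then obtain a where "?e j - a *s ?e i \<in> coset 0"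
      by (auto simp: vec.span_insert span_C)
    then have "?e j - a *s ?e i = 0"
      by (rule light) (auto simp: supp_def ijk axis_def)
    then have "(?e j - a *s ?e i) $ j = 0"
      by simp
    then show False
      using ijk by (simp add: axis_def)
  qed
  moreover have "?e k \<notin> vec.span (insert (?e j) (insert (?e i) (coset 0)))"
  proof
    assume "?e k \<in> vec.span (insert (?e j) (insert (?e i) (coset 0)))"
    then obtain b a where "?e k - b *s ?e j - a *s ?e i \<in> coset 0"
      by (auto simp: vec.span_insert span_C)
    then have "?e k - b *s ?e j - a *s ?e i = 0"
      by (rule light) (auto simp: supp_def ijk axis_def)
    then have "(?e k - b *s ?e j - a *s ?e i) $ k = 0"
      by simp
    then show False
      using ijk by (simp add: axis_def)
  qed
  ultimately show ?thesis
    by (simp add: vec.dim_insert)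
qed

end

text \<open>The terms containing \<open>i\<close> cancel by the symmetry of the binomial
  coefficients under \<open>w \<mapsto> n + 2 - w\<close>. The right-hand side is thus the same for
  all classes.\<close>

lemma D2_class_difference:
  fixes C :: "('a::{plus,zero} ^ 'n::finite) set"
  assumes "V \<in> D2_class C i" "w \<in> {3..CARD('n)}" "n = CARD('n)"
  shows "(-1) ^ n * num_weight V w - num_weight V (n + 2 - w)
    = (-1) ^ n * (num_weight C w - Omega4 0 w n)
      - (if w = n then 0 else num_weight C (n + 2 - w) - Omega4 0 (n + 2 - w) n)"
proof -
  have V: "num_weight V 2 = int i" "\<And>w. w \<in> {3..n} \<Longrightarrow> num_weight V w =
      num_weight C w - Omega4 0 w n + (-1) ^ w * int ((n - 2) choose (n - w)) * int i"
    using assms by (auto simp: D2_class_def distr_D2_def Let_def)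
  show ?thesis
  proof (cases "w = n")
    \<comment> \<open>Here \<open>n + 2 - w = 2\<close> lies below the range of the general formula;
      the count of weight 2, namely \<open>i\<close>, is used instead.\<close>
    case True
    then show ?thesis
      using V(1) V(2)[of w] assms(2,3) by (cases "even n") (simp_all add: algebra_simps)
  next
    case False
    have "n - (n + 2 - w) = n - 2 - (n - w)" "n - w \<le> n - 2"
      using assms by auto
    then have "(n - 2) choose (n - (n + 2 - w)) = (n - 2) choose (n - w)"
      by (metis binomial_symmetric)
    moreover have "(-1 :: int) ^ (n + 2 - w) = (-1) ^ n * (-1) ^ w"
      using assms by (simp add: minus_one_power_iff)
    moreover have "n + 2 - w \<in> {3..n}"
      using False assms by auto
    ultimately show ?thesis
      using V(2)[of w] V(2)[of "n + 2 - w"] False assms(2,3)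
      by (cases "even n") (simp_all add: algebra_simps)
  qed
qed

section \<open>Chords of the punctured conic\<close>

lemma card_two_to_one:
  assumes "finite A" "\<And>x. x \<in> A \<Longrightarrow> card {z \<in> A. f z = f x} = 2"
  shows "card A = 2 * card (f ` A)"
proof -
  have "card A = (\<Sum>d\<in>f ` A. card {z \<in> A. f z = d})"
    using sum.image_gen[OF assms(1), of "\<lambda>_. 1 :: nat" f] by simp
  also have "\<dots> = (\<Sum>d\<in>f ` A. 2)"
    using assms(2) by (intro sum.cong) auto
  finally show ?thesis
    by simp
qed

text \<open>In characteristic 2 the map \<open>x * (x + 1)\<close> has the fibres
  \<open>{x, x + 1}\<close>, so it is two-to-one on the whole field.\<close>

lemma CARD_even_if_two_eq_0:
  assumes "(2 :: 'a::{field,finite}) = 0"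
  shows "even CARD('a)"
proof -
  have neg: "- x = x" for x :: 'a
    using assms by (metis add_eq_0_iff mult_2 mult_zero_left)
  have "{z. z * (z + 1) = x * (x + 1)} = {x, x + 1}" for x :: 'a
  proof -
    have "z * (z + 1) - x * (x + 1) = (z - x) * (z - (- (x + 1)))" for z
      by (simp add: algebra_simps)
    then have "z * (z + 1) = x * (x + 1) \<longleftrightarrow> z = x \<or> z = - (x + 1)" for z
      by (metis eq_iff_diff_eq_0 mult_eq_0_iff)
    then show ?thesis
      unfolding neg by blast
  qed
  then have "CARD('a) = 2 * card (range (\<lambda>x :: 'a. x * (x + 1)))"
    by (intro card_two_to_one) auto
  then show ?thesis
    by simp
qed

lemma sqrt_set_eq:
  fixes z :: "'a::field"
  shows "{x. x\<^sup>2 = z\<^sup>2} = {z, - z}"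
  by (auto simp: power2_eq_iff)

lemma card_sqrt_set:
  fixes d :: "'a::field"
  assumes "(2 :: 'a) \<noteq> 0" "d \<noteq> 0"
  shows "card {z. z\<^sup>2 = d} = (if \<exists>z. z\<^sup>2 = d then 2 else 0)"
proof (cases "\<exists>z. z\<^sup>2 = d")
  case True
  then obtain z where z: "d = z\<^sup>2"
    by blast
  have "z \<noteq> - z"
    using assms z by (auto simp: eq_neg_iff_add_eq_0 simp flip: mult_2)
  then have "card {x. x\<^sup>2 = d} = 2"
    unfolding z sqrt_set_eq by simp
  with True show ?thesis
    by simp
qed auto

lemma card_nonzero_squares:
  assumes "(2 :: 'a::{field,finite}) \<noteq> 0"
  shows "2 * card {d :: 'a. d \<noteq> 0 \<and> (\<exists>z. z\<^sup>2 = d)} = CARD('a) - 1"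
proof -
  have "card {z \<in> UNIV - {0}. z\<^sup>2 = x\<^sup>2} = 2" if "x \<in> UNIV - {0}" for x :: 'a
  proof -
    have "{z \<in> UNIV - {0}. z\<^sup>2 = x\<^sup>2} = {z. z\<^sup>2 = x\<^sup>2}"
      using that by auto
    then show ?thesis
      using card_sqrt_set[OF assms, of "x\<^sup>2"] that by auto
  qed
  then have "card (UNIV - {0 :: 'a}) = 2 * card ((\<lambda>x. x\<^sup>2) ` (UNIV - {0 :: 'a}))"
    by (intro card_two_to_one) auto
  moreover have "(\<lambda>x. x\<^sup>2) ` (UNIV - {0 :: 'a}) = {d. d \<noteq> 0 \<and> (\<exists>z. z\<^sup>2 = d)}"
    by auto
  ultimately show ?thesis
    by (simp add: card_Diff_subset)
qed

lemma odd_CARD_iff: "odd CARD('a::{field,finite}) \<longleftrightarrow> (2 :: 'a) \<noteq> 0"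
proof
  assume "(2 :: 'a) \<noteq> 0"
  then have "CARD('a) - 1 = 2 * card {d :: 'a. d \<noteq> 0 \<and> (\<exists>z. z\<^sup>2 = d)}"
    by (rule card_nonzero_squares[symmetric])
  moreover have "0 < CARD('a)"
    by simp
  ultimately have "CARD('a) = Suc (2 * card {d :: 'a. d \<noteq> 0 \<and> (\<exists>z. z\<^sup>2 = d)})"
    by linarith
  then show "odd CARD('a)"
    by simp
qed (use CARD_even_if_two_eq_0 in blast)

text \<open>Squaring is injective in characteristic 2, hence bijective on a finite field.\<close>

lemma card_sqrt_set_char2:
  fixes d :: "'a::{field,finite}"
  assumes "(2 :: 'a) = 0"
  shows "card {z. z\<^sup>2 = d} = 1"
proof -
  have "inj (\<lambda>z :: 'a. z\<^sup>2)"
  proof (rule injI)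
    fix x y :: 'a assume "x\<^sup>2 = y\<^sup>2"
    moreover have "- y = y"
      using assms by (metis add_eq_0_iff mult_2 mult_zero_left)
    ultimately show "x = y"
      by (auto simp: power2_eq_iff)
  qed
  moreover from this have sq_onto: "surj (\<lambda>z :: 'a. z\<^sup>2)"
    by (simp add: finite_UNIV_inj_surj)
  moreover obtain z where "z\<^sup>2 = d"
    using surjD[OF sq_onto, of d] by blast
  ultimately have "{x. x\<^sup>2 = d} = {z}"
    by (auto dest: injD)
  then show ?thesis
    by simp
qed

section \<open>Counting secants through a point\<close>

text \<open>The nonzero multiples of the points \<open>(1, t, t\<^sup>2)\<close> with \<open>t \<noteq> 0\<close>.\<close>

definition conic_cone :: "('a::field \<times> 'a \<times> 'a) set" where
  "conic_cone = {(y0, y1, y2). y0 \<noteq> 0 \<and> y1 \<noteq> 0 \<and> y1\<^sup>2 = y0 * y2}"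

text \<open>\<open>secant_params y\<close> are the parameters \<open>t\<close> such that the line through \<open>y\<close> and
  \<open>(1, t, t\<^sup>2)\<close> meets the conic in a second point \<open>(1, u, u\<^sup>2)\<close> with \<open>u \<noteq> 0\<close>. The three
  conditions exclude \<open>u = \<infinity>\<close>, \<open>u = 0\<close> and tangency.\<close>

definition secant_params :: "'a::field \<times> 'a \<times> 'a \<Rightarrow> 'a set" where
  "secant_params = (\<lambda>(y0, y1, y2).
     {t. t \<noteq> 0 \<and> t * y0 \<noteq> y1 \<and> t * y1 \<noteq> y2 \<and> t\<^sup>2 * y0 - 2 * t * y1 + y2 \<noteq> 0})"

lemma card_conic_cone: "card (conic_cone :: ('a::{field,finite} \<times> 'a \<times> 'a) set) = (CARD('a) - 1)\<^sup>2"
proof -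
  have "bij_betw (\<lambda>(y0, y1). (y0, y1, y1\<^sup>2 / y0)) ((UNIV - {0}) \<times> (UNIV - {0})) (conic_cone :: ('a \<times> 'a \<times> 'a) set)"
    by (rule bij_betw_byWitness[where f' = "\<lambda>(y0, y1, y2). (y0, y1)"])
       (auto simp: conic_cone_def field_simps)
  from bij_betw_same_card[OF this] show ?thesis
    by (simp add: card_cartesian_product card_Diff_subset power2_eq_square)
qed

text \<open>Completes the square with \<open>z = y0 * t - y1\<close>. No division by 2 occurs, so
  the bijection covers characteristic 2 as well.\<close>

lemma card_conic_roots:
  fixes y0 y1 y2 :: "'a::field"
  assumes "y0 \<noteq> 0"
  shows "card {t. t\<^sup>2 * y0 - 2 * t * y1 + y2 = 0} = card {z. z\<^sup>2 = y1\<^sup>2 - y0 * y2}"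
proof (rule bij_betw_same_card[where f = "\<lambda>t. y0 * t - y1"], rule bij_betw_byWitness[where f' = "\<lambda>z. (z + y1) / y0"])
  have eq: "(y0 * t - y1)\<^sup>2 = y1\<^sup>2 - y0 * y2 + y0 * (t\<^sup>2 * y0 - 2 * t * y1 + y2)" for t
    by (simp add: power2_eq_square algebra_simps)
  show "(\<lambda>t. y0 * t - y1) ` {t. t\<^sup>2 * y0 - 2 * t * y1 + y2 = 0} \<subseteq> {z. z\<^sup>2 = y1\<^sup>2 - y0 * y2}"
    by (auto simp: eq)
  show "(\<lambda>z. (z + y1) / y0) ` {z. z\<^sup>2 = y1\<^sup>2 - y0 * y2} \<subseteq> {t. t\<^sup>2 * y0 - 2 * t * y1 + y2 = 0}"
  proof clarify
    fix z assume "z\<^sup>2 = y1\<^sup>2 - y0 * y2"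
    moreover have "y0 * ((z + y1) / y0) - y1 = z"
      using assms by simp
    ultimately have "y0 * (((z + y1) / y0)\<^sup>2 * y0 - 2 * ((z + y1) / y0) * y1 + y2) = 0"
      using eq[of "(z + y1) / y0"] by (metis add_cancel_right_right)
    with assms show "((z + y1) / y0)\<^sup>2 * y0 - 2 * ((z + y1) / y0) * y1 + y2 = 0"
      by (metis mult_eq_0_iff)
  qed
qed (use assms in auto)

lemma card_secant_params_generic:
  fixes y0 y1 y2 :: "'a::{field,finite}"
  assumes nz: "y0 \<noteq> 0" "y1 \<noteq> 0" "y2 \<noteq> 0" and d: "y1\<^sup>2 \<noteq> y0 * y2"
  shows "card (secant_params (y0, y1, y2)) = CARD('a) - (3 + card {z. z\<^sup>2 = y1\<^sup>2 - y0 * y2})"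
proof -
  define R where "R = {t. t\<^sup>2 * y0 - 2 * t * y1 + y2 = 0}"
  define A where "A = {0, y1 / y0, y2 / y1}"
  have "secant_params (y0, y1, y2) = UNIV - (A \<union> R)"
    unfolding A_def R_def using nz by (auto simp: secant_params_def field_simps)
  moreover have "card A = 3"
    unfolding A_def R_def using nz d by (auto simp: field_simps power2_eq_square)
  \<comment> \<open>The quadratic is \<open>t * (t * y0 - y1) - (t * y1 - y2)\<close>. At a root in
    \<open>A\<close> both linear expressions vanish, which would put \<open>y\<close> on the
    conic.\<close>
  moreover have "t \<notin> R" if "t \<in> A" for t
  proof
    assume "t \<in> R"
    then have R: "t\<^sup>2 * y0 - 2 * t * y1 + y2 = 0"
      by (simp add: R_def)
    from that nz have "t = 0 \<or> t * y0 = y1 \<or> t * y1 = y2"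
      by (auto simp: A_def)
    moreover have "t\<^sup>2 * y0 - 2 * t * y1 + y2 = t * (t * y0 - y1) - (t * y1 - y2)"
      by (simp add: power2_eq_square algebra_simps)
    ultimately have "t * y0 = y1 \<and> t * y1 = y2"
      using R nz(3) by auto
    with d show False
      by (metis mult.assoc mult.commute power2_eq_square)
  qed
  then have "A \<inter> R = {}"
    by blast
  ultimately show ?thesis
    using card_conic_roots[OF nz(1), of y1 y2] by (simp add: R_def[symmetric] card_Diff_subset card_Un_disjoint)
qed

text \<open>The point lies on the line joining the two removed points, so no line from it to a
  remaining point passes through a removed one. Only tangency is left to exclude.\<close>

lemma card_secant_params_chord:
  fixes y0 y2 :: "'a::{field,finite}"
  assumes nz: "y0 \<noteq> 0" "y2 \<noteq> 0"
  shows "card (secant_params (y0, 0, y2)) = CARD('a) - (1 + card {z. z\<^sup>2 = - (y0 * y2)})"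
proof -
  define R where "R = {t. t\<^sup>2 * y0 - 2 * t * 0 + y2 = 0}"
  have "secant_params (y0, 0, y2) = UNIV - ({0} \<union> R)"
    using nz by (auto simp: secant_params_def R_def)
  moreover have "{0} \<inter> R = {}"
    using nz by (auto simp: R_def)
  ultimately show ?thesis
    using card_conic_roots[OF nz(1), of 0 y2] by (simp add: R_def card_Diff_subset card_Un_disjoint)
qed

lemma secant_params_removed_point:
  "secant_params (0, 0, y2) = {}" "secant_params (y0, 0, 0) = {}"
  by (auto simp: secant_params_def)

text \<open>The point \<open>(0, 1, 0)\<close> is where the tangents at the removed points meet. In
  characteristic 2 it is the nucleus, which lies on every tangent; otherwise these two are its only
  tangents.\<close>

lemma secant_params_pole:
  fixes y1 :: "'a::field"
  assumes "y1 \<noteq> 0"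
  shows "secant_params (0, y1, 0) = (if (2 :: 'a) = 0 then {} else UNIV - {0})"
  using assms by (auto simp: secant_params_def)

text \<open>The point lies on the tangent at exactly one removed point. Besides 0, one parameter
  belongs to the line through the other removed point and, in odd characteristic, a further one to
  the second tangent.\<close>

lemma card_secant_params_tangent:
  fixes y0 y1 y2 :: "'a::{field,finite}"
  assumes "y1 \<noteq> 0" "y0 = 0 \<and> y2 \<noteq> 0 \<or> y0 \<noteq> 0 \<and> y2 = 0"
  shows "card (secant_params (y0, y1, y2)) = CARD('a) - (if (2 :: 'a) = 0 then 2 else 3)"
proof -
  have [simp]: "(2 :: 'a) \<noteq> 1"
    by (metis add_cancel_right_right one_add_one zero_neq_one)
  \<comment> \<open>In characteristic 2 the element \<open>2 * c\<close> coincides with 0, so one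
    set expression covers both counts.\<close>
  have *: "card (UNIV - {0, c, 2 * c}) = CARD('a) - (if (2 :: 'a) = 0 then 2 else 3)"
    "card (UNIV - {0, 2 * c, c}) = CARD('a) - (if (2 :: 'a) = 0 then 2 else 3)" if "c \<noteq> 0" for c :: 'a
    using that by (auto simp: card_Diff_subset card_insert_if)
  from assms(2) show ?thesis
  proof
    assume y: "y0 = 0 \<and> y2 \<noteq> 0"
    show ?thesis
    proof (cases "(2 :: 'a) = 0")
      case True
      then have "secant_params (y0, y1, y2) = UNIV - {0, y2 / y1, 2 * (y2 / y1)}"
        using y assms(1) by (auto simp: secant_params_def nonzero_eq_divide_eq)
      then show ?thesis
        using *(1)[of "y2 / y1"] y assms(1) by simp
    next
      case False
      then have "secant_params (y0, y1, y2) = UNIV - {0, 2 * (y2 / (2 * y1)), y2 / (2 * y1)}"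
        using y assms(1) by (auto simp: secant_params_def nonzero_eq_divide_eq ac_simps)
      then show ?thesis
        using *(2)[of "y2 / (2 * y1)"] y assms(1) False by simp
    qed
  next
    assume y: "y0 \<noteq> 0 \<and> y2 = 0"
    have "t\<^sup>2 * y0 - 2 * t * y1 = t * (t * y0 - 2 * y1)" for t
      by (simp add: power2_eq_square algebra_simps)
    then have "secant_params (y0, y1, y2) = UNIV - {0, y1 / y0, 2 * (y1 / y0)}"
      using y assms(1) by (auto simp: secant_params_def nonzero_eq_divide_eq)
    then show ?thesis
      using *(1)[of "y1 / y0"] y assms(1) by simp
  qed
qed

section \<open>Sizes of the syndrome classes\<close>

text \<open>Nonzero syndromes of cosets of weight at least 2, sorted by \<open>k\<close>, which will
  turn out to be twice the number of vectors of weight 2.\<close>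

definition off_cone :: "nat \<Rightarrow> ('a::field \<times> 'a \<times> 'a) set" where
  "off_cone k = {y. y \<noteq> 0 \<and> y \<notin> conic_cone \<and> card (secant_params y) = k}"

lemma card_off_cone_total:
  "card {y :: 'a::{field,finite} \<times> 'a \<times> 'a. y \<noteq> 0 \<and> y \<notin> conic_cone} + (1 + (CARD('a) - 1)\<^sup>2)
    = CARD('a) ^ 3"
proof -
  let ?O = "{y :: 'a \<times> 'a \<times> 'a. y \<noteq> 0 \<and> y \<notin> conic_cone}"
  have "0 \<notin> (conic_cone :: ('a \<times> 'a \<times> 'a) set)"
    by (simp add: conic_cone_def zero_prod_def)
  then have "card (insert 0 (conic_cone :: ('a \<times> 'a \<times> 'a) set)) = 1 + (CARD('a) - 1)\<^sup>2"
    by (simp add: card_conic_cone)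
  moreover have "?O \<union> insert 0 conic_cone = UNIV" "?O \<inter> insert 0 conic_cone = {}"
    by auto
  then have "card ?O + card (insert 0 (conic_cone :: ('a \<times> 'a \<times> 'a) set)) = CARD('a \<times> 'a \<times> 'a)"
    using card_Un_disjoint[of ?O "insert 0 conic_cone"] by (simp only: finite)
  ultimately show ?thesis
    by (simp add: power3_eq_cube)
qed

text \<open>Zero, the cone and the classes partition all triples, so the size of one class follows
  from those of the others.\<close>

lemma sum_card_off_cone:
  assumes "finite K"
    and "\<And>y :: 'a::{field,finite} \<times> 'a \<times> 'a. y \<notin> conic_cone \<Longrightarrow> card (secant_params y) \<in> K"
  shows "(\<Sum>k\<in>K. card (off_cone k :: ('a \<times> 'a \<times> 'a) set)) + (1 + (CARD('a) - 1)\<^sup>2)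
    = CARD('a) ^ 3"
proof -
  have "{y :: 'a \<times> 'a \<times> 'a. y \<noteq> 0 \<and> y \<notin> conic_cone} = (\<Union>k\<in>K. off_cone k)"
    using assms(2) by (auto simp: off_cone_def)
  then have "card {y :: 'a \<times> 'a \<times> 'a. y \<noteq> 0 \<and> y \<notin> conic_cone} = (\<Sum>k\<in>K. card (off_cone k :: ('a \<times> 'a \<times> 'a) set))"
    using assms(1) by (simp add: card_UN_disjoint off_cone_def disjoint_iff)
  then show ?thesis
    using card_off_cone_total[where 'a = 'a] by simp
qed

lemma card_nonzero: "card (UNIV - {0 :: 'a::{zero,finite}}) = CARD('a) - 1"
  by (simp add: card_Diff_subset)

lemma card_removed_points:
  "card {(y0 :: 'a::{field,finite}, y1 :: 'a, y2 :: 'a). y1 = 0 \<and> (y0 = 0) \<noteq> (y2 = 0)} = 2 * (CARD('a) - 1)"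
proof -
  define A where "A = {0 :: 'a} \<times> {0 :: 'a} \<times> (UNIV - {0 :: 'a})"
  define B where "B = (UNIV - {0 :: 'a}) \<times> {0 :: 'a} \<times> {0 :: 'a}"
  have "{(y0 :: 'a, y1 :: 'a, y2 :: 'a). y1 = 0 \<and> (y0 = 0) \<noteq> (y2 = 0)} = A \<union> B"
    by (auto simp: A_def B_def)
  moreover have "A \<inter> B = {}"
    by (auto simp: A_def B_def)
  moreover have "card A = CARD('a) - 1" "card B = CARD('a) - 1"
    by (simp_all add: A_def B_def card_cartesian_product card_nonzero)
  ultimately show ?thesis
    by (simp add: card_Un_disjoint)
qed

lemma conic_cone_iff [simp]: "(y0, y1, y2) \<in> conic_cone \<longleftrightarrow> y0 \<noteq> 0 \<and> y1 \<noteq> 0 \<and> y1\<^sup>2 = y0 * y2"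
  by (simp add: conic_cone_def)

section \<open>Class sizes in odd characteristic\<close>

context
  fixes m :: nat
  assumes odd_char: "(2 :: 'a::{field,finite}) \<noteq> 0" and card_eq: "CARD('a) = 2 * m + 1"
begin

lemma card_secant_params_odd:
  fixes y0 y1 y2 :: 'a
  assumes "(y0, y1, y2) \<notin> conic_cone"
  shows "card (secant_params (y0, y1, y2)) =
    (if y1 = 0 then if y0 = 0 \<or> y2 = 0 then 0 else if \<exists>z. z\<^sup>2 = - (y0 * y2) then 2 * m - 2 else 2 * m
     else if y0 = 0 \<and> y2 = 0 then 2 * m else if y0 = 0 \<or> y2 = 0 then 2 * m - 2
     else if \<exists>z. z\<^sup>2 = y1\<^sup>2 - y0 * y2 then 2 * m - 4 else 2 * m - 2)"
proof -
  consider (removed) "y1 = 0" "y0 = 0 \<or> y2 = 0" | (chord) "y1 = 0" "y0 \<noteq> 0" "y2 \<noteq> 0"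
    | (pole) "y1 \<noteq> 0" "y0 = 0" "y2 = 0" | (tangent) "y1 \<noteq> 0" "y0 = 0 \<and> y2 \<noteq> 0 \<or> y0 \<noteq> 0 \<and> y2 = 0"
    | (generic) "y1 \<noteq> 0" "y0 \<noteq> 0" "y2 \<noteq> 0"
    by blast
  then show ?thesis
  proof cases
    case removed
    then show ?thesis
      by (auto simp: secant_params_removed_point)
  next
    case chord
    then show ?thesis
      using card_sqrt_set[OF odd_char, of "- (y0 * y2)"]
      by (simp add: card_secant_params_chord card_eq)
  next
    case pole
    then show ?thesis
      by (simp add: secant_params_pole odd_char card_nonzero card_eq)
  next
    case tangent
    then show ?thesis
      using card_secant_params_tangent[OF tangent] odd_char by (auto simp: card_eq)
  next
    case generic
    with assms show ?thesis
      using card_sqrt_set[OF odd_char, of "y1\<^sup>2 - y0 * y2"]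
      by (auto simp: card_secant_params_generic card_eq)
  qed
qed

lemma off_cone_odd_iff:
  fixes y0 y1 y2 :: 'a
  shows "(y0, y1, y2) \<in> off_cone k \<longleftrightarrow>
    (y0 \<noteq> 0 \<or> y1 \<noteq> 0 \<or> y2 \<noteq> 0) \<and> \<not> (y0 \<noteq> 0 \<and> y1 \<noteq> 0 \<and> y1\<^sup>2 = y0 * y2) \<and>
    (if y1 = 0 then if y0 = 0 \<or> y2 = 0 then 0 else if \<exists>z. z\<^sup>2 = - (y0 * y2) then 2 * m - 2 else 2 * m
     else if y0 = 0 \<and> y2 = 0 then 2 * m else if y0 = 0 \<or> y2 = 0 then 2 * m - 2
     else if \<exists>z. z\<^sup>2 = y1\<^sup>2 - y0 * y2 then 2 * m - 4 else 2 * m - 2) = k"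
  unfolding off_cone_def mem_Collect_eq zero_prod_def prod.inject de_Morgan_conj conic_cone_iff[symmetric]
  by (rule conj_cong[OF refl], rule conj_cong[OF refl]) (subst card_secant_params_odd, assumption, rule refl)

lemma card_squares: "card {d :: 'a. d \<noteq> 0 \<and> (\<exists>z. z\<^sup>2 = d)} = m"
  using card_nonzero_squares[OF odd_char] by (simp add: card_eq)

lemma card_nonsquares: "card {d :: 'a. \<not> (\<exists>z. z\<^sup>2 = d)} = m"
proof -
  have "{d :: 'a. \<not> (\<exists>z. z\<^sup>2 = d)} = UNIV - insert 0 {d. d \<noteq> 0 \<and> (\<exists>z. z\<^sup>2 = d)}"
    by auto
  then show ?thesis
    using card_squares by (simp add: card_Diff_subset card_eq)
qed

text \<open>Only the multiples of the two removed points lie on no chord; \<open>m \<ge> 3\<close>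
  keeps \<open>2 * m - 4\<close> away from 0.\<close>

lemma card_off_cone_0_odd:
  assumes "m \<ge> 3"
  shows "card (off_cone 0 :: ('a \<times> 'a \<times> 'a) set) = 4 * m"
proof -
  have "off_cone 0 = {(y0 :: 'a, y1 :: 'a, y2 :: 'a). y1 = 0 \<and> (y0 = 0) \<noteq> (y2 = 0)}"
    using assms by (auto simp: off_cone_odd_iff split: if_splits)
  then show ?thesis
    by (simp only: card_removed_points card_eq)
qed

text \<open>No parameter but 0 is excluded for points without tangents on the line through the
  removed points (\<open>A\<close>), and for the pole of that line (\<open>B\<close>).\<close>

lemma card_off_cone_max_odd:
  assumes "m \<ge> 3"
  shows "card (off_cone (2 * m) :: ('a \<times> 'a \<times> 'a) set) = 2 * m * (m + 1)"
proof -
  define N where "N = {d :: 'a. \<not> (\<exists>z. z\<^sup>2 = d)}"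
  define A where "A = {(y0 :: 'a, y1 :: 'a, y2 :: 'a). y1 = 0 \<and> y0 \<noteq> 0 \<and> - (y0 * y2) \<in> N}"
  define B where "B = {0 :: 'a} \<times> (UNIV - {0 :: 'a}) \<times> {0 :: 'a}"
  have "0 \<notin> N"
    by (auto simp: N_def intro!: exI[of _ 0])
  then have "off_cone (2 * m) = A \<union> B"
    using assms
    by (auto simp: off_cone_odd_iff A_def B_def N_def split: if_splits)
  moreover have "bij_betw (\<lambda>(y0, d). (y0, 0, - d / y0)) ((UNIV - {0}) \<times> N) A"
    by (rule bij_betw_byWitness[where f' = "\<lambda>(y0, y1, y2). (y0, - (y0 * y2))"]) (auto simp: A_def)
  then have "card A = 2 * m * m"
    using card_nonsquares bij_betw_same_card
    by (fastforce simp: card_cartesian_product card_nonzero card_eq N_def)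
  moreover have "card B = 2 * m"
    by (simp add: B_def card_cartesian_product card_nonzero card_eq)
  moreover have "A \<inter> B = {}"
    by (auto simp: A_def B_def)
  ultimately show ?thesis
    by (simp add: card_Un_disjoint)
qed

text \<open>These are the points with no zero coordinate whose discriminant \<open>d\<close> is a
  nonzero square. Given \<open>y0\<close>, \<open>y1\<close> and \<open>d\<close>, the last
  coordinate is determined; it is nonzero unless \<open>d = y1\<^sup>2\<close>, which removes one of
  the \<open>m\<close> squares.\<close>

lemma card_off_cone_min_odd:
  assumes "m \<ge> 3"
  shows "card (off_cone (2 * m - 4) :: ('a \<times> 'a \<times> 'a) set) = 4 * m * m * (m - 1)"
proof -
  define Q where "Q = {d :: 'a. d \<noteq> 0 \<and> (\<exists>z. z\<^sup>2 = d)}"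
  have "off_cone (2 * m - 4) = {(y0 :: 'a, y1 :: 'a, y2 :: 'a).
      y0 \<noteq> 0 \<and> y1 \<noteq> 0 \<and> y2 \<noteq> 0 \<and> y1\<^sup>2 - y0 * y2 \<in> Q}" (is "_ = ?A")
    using assms
    by (auto simp: off_cone_odd_iff Q_def split: if_splits)
  moreover have "bij_betw (\<lambda>(y0, y1, d). (y0, y1, (y1\<^sup>2 - d) / y0))
      ((UNIV - {0}) \<times> (SIGMA y1 : UNIV - {0}. Q - {y1\<^sup>2})) ?A"
    by (rule bij_betw_byWitness[where f' = "\<lambda>(y0, y1, y2). (y0, y1, y1\<^sup>2 - y0 * y2)"]) auto
  then have "card ?A = card ((UNIV - {0 :: 'a}) \<times> (SIGMA y1 : UNIV - {0}. Q - {y1\<^sup>2}))"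
    by (rule bij_betw_same_card[symmetric])
  moreover have "card (SIGMA y1 : UNIV - {0}. Q - {y1\<^sup>2}) = 2 * m * (m - 1)"
  proof -
    have "card (Q - {y1\<^sup>2}) = m - 1" if "y1 \<noteq> 0" for y1
      using card_squares that by (subst card_Diff_singleton) (auto simp: Q_def)
    then show ?thesis
      by (simp add: card_nonzero card_eq)
  qed
  ultimately show ?thesis
    by (simp add: card_cartesian_product card_nonzero card_eq)
qed

lemma card_secant_params_odd_values:
  fixes y :: "'a \<times> 'a \<times> 'a"
  assumes "y \<notin> conic_cone"
  shows "card (secant_params y) \<in> {0, 2 * m, 2 * m - 2, 2 * m - 4}"
  using assms by (cases y) (auto simp: card_secant_params_odd)

lemma card_off_cone_mid_odd:
  assumes "m \<ge> 3"
  shows "card (off_cone (2 * m - 2) :: ('a \<times> 'a \<times> 'a) set) = 2 * m * m * (2 * m + 5)"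
proof -
  have "distinct [0, 2 * m, 2 * m - 2, 2 * m - 4]"
    using assms by auto
  then have "(\<Sum>k\<in>{0, 2 * m, 2 * m - 2, 2 * m - 4}. card (off_cone k :: ('a \<times> 'a \<times> 'a) set))
      = 4 * m + 2 * m * (m + 1) + card (off_cone (2 * m - 2) :: ('a \<times> 'a \<times> 'a) set) + 4 * m * m * (m - 1)"
    using assms card_off_cone_0_odd card_off_cone_max_odd card_off_cone_min_odd by simp
  with sum_card_off_cone[OF _ card_secant_params_odd_values]
  have *: "4 * m + 2 * m * (m + 1) + card (off_cone (2 * m - 2) :: ('a \<times> 'a \<times> 'a) set)
      + 4 * m * m * (m - 1) + (1 + (2 * m)\<^sup>2) = (2 * m + 1) ^ 3"
    by (simp add: card_eq)
  \<comment> \<open>Makes the truncated subtraction \<open>m - 1\<close> disappear, so that the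
    equation becomes polynomial.\<close>
  obtain l where "m = Suc l"
    using assms by (cases m) auto
  with * show ?thesis
    by (simp add: power3_eq_cube power2_eq_square algebra_simps)
qed

end

section \<open>Class sizes in characteristic 2\<close>

context
  assumes char_2: "(2 :: 'a::{field,finite}) = 0"
begin

lemma card_secant_params_even:
  fixes y0 y1 y2 :: 'a
  assumes "(y0, y1, y2) \<notin> conic_cone"
  shows "card (secant_params (y0, y1, y2)) =
    (if y1 = 0 then if y0 = 0 \<or> y2 = 0 then 0 else CARD('a) - 2
     else if y0 = 0 \<and> y2 = 0 then 0 else if y0 = 0 \<or> y2 = 0 then CARD('a) - 2
     else CARD('a) - 4)"
proof -
  consider (removed) "y1 = 0" "y0 = 0 \<or> y2 = 0" | (chord) "y1 = 0" "y0 \<noteq> 0" "y2 \<noteq> 0"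
    | (nucleus) "y1 \<noteq> 0" "y0 = 0" "y2 = 0" | (tangent) "y1 \<noteq> 0" "y0 = 0 \<and> y2 \<noteq> 0 \<or> y0 \<noteq> 0 \<and> y2 = 0"
    | (generic) "y1 \<noteq> 0" "y0 \<noteq> 0" "y2 \<noteq> 0"
    by blast
  then show ?thesis
  proof cases
    case removed
    then show ?thesis
      by (auto simp: secant_params_removed_point)
  next
    case chord
    then show ?thesis
      using card_sqrt_set_char2[OF char_2, of "- (y0 * y2)"]
      by (simp add: card_secant_params_chord)
  next
    case nucleus
    then show ?thesis
      by (simp add: secant_params_pole char_2)
  next
    case tangent
    then show ?thesis
      using card_secant_params_tangent[OF tangent] char_2 by auto
  next
    case generic
    with assms show ?thesis
      using card_sqrt_set_char2[OF char_2, of "y1\<^sup>2 - y0 * y2"]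
      by (simp add: card_secant_params_generic)
  qed
qed

lemma off_cone_even_iff:
  fixes y0 y1 y2 :: 'a
  shows "(y0, y1, y2) \<in> off_cone k \<longleftrightarrow>
    (y0 \<noteq> 0 \<or> y1 \<noteq> 0 \<or> y2 \<noteq> 0) \<and> \<not> (y0 \<noteq> 0 \<and> y1 \<noteq> 0 \<and> y1\<^sup>2 = y0 * y2) \<and>
    (if y1 = 0 then if y0 = 0 \<or> y2 = 0 then 0 else CARD('a) - 2
     else if y0 = 0 \<and> y2 = 0 then 0 else if y0 = 0 \<or> y2 = 0 then CARD('a) - 2
     else CARD('a) - 4) = k"
  unfolding off_cone_def mem_Collect_eq zero_prod_def prod.inject de_Morgan_conj conic_cone_iff[symmetric]
  by (rule conj_cong[OF refl], rule conj_cong[OF refl]) (subst card_secant_params_even, assumption, rule refl)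

text \<open>The multiples of the nucleus (\<open>B\<close>) join those of the two removed points
  (\<open>A\<close>).\<close>

lemma card_off_cone_0_even:
  assumes "CARD('a) \<ge> 7"
  shows "card (off_cone 0 :: ('a \<times> 'a \<times> 'a) set) = 3 * (CARD('a) - 1)"
proof -
  define A where "A = {(y0 :: 'a, y1 :: 'a, y2 :: 'a). y1 = 0 \<and> (y0 = 0) \<noteq> (y2 = 0)}"
  define B where "B = {0 :: 'a} \<times> (UNIV - {0 :: 'a}) \<times> {0 :: 'a}"
  have "off_cone 0 = A \<union> B"
    using assms
    by (auto simp: off_cone_even_iff A_def B_def split: if_splits)
  moreover have "A \<inter> B = {}"
    by (auto simp: A_def B_def)
  moreover have "card A = 2 * (CARD('a) - 1)"
    unfolding A_def by (rule card_removed_points)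
  moreover have "card B = CARD('a) - 1"
    by (simp add: B_def card_cartesian_product card_nonzero)
  ultimately show ?thesis
    by (simp add: card_Un_disjoint)
qed

text \<open>All points off the conic without zero coordinates belong here, each having exactly one
  tangent. In terms of \<open>d = y0 * y2\<close> the excluded values are 0 and
  \<open>y1\<^sup>2\<close>.\<close>

lemma card_off_cone_min_even:
  assumes "CARD('a) \<ge> 7"
  shows "card (off_cone (CARD('a) - 4) :: ('a \<times> 'a \<times> 'a) set) = (CARD('a) - 1)\<^sup>2 * (CARD('a) - 2)"
proof -
  have "off_cone (CARD('a) - 4) = {(y0 :: 'a, y1 :: 'a, y2 :: 'a).
      y0 \<noteq> 0 \<and> y1 \<noteq> 0 \<and> y2 \<noteq> 0 \<and> y1\<^sup>2 \<noteq> y0 * y2}" (is "_ = ?A")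
    using assms
    by (auto simp: off_cone_even_iff split: if_splits)
  moreover have "bij_betw (\<lambda>(y0, y1, d). (y0, y1, d / y0))
      ((UNIV - {0}) \<times> (SIGMA y1 : UNIV - {0}. UNIV - {0, y1\<^sup>2})) ?A"
    by (rule bij_betw_byWitness[where f' = "\<lambda>(y0, y1, y2). (y0, y1, y0 * y2)"]) auto
  then have "card ?A = card ((UNIV - {0 :: 'a}) \<times> (SIGMA y1 : UNIV - {0 :: 'a}. UNIV - {0, y1\<^sup>2}))"
    by (rule bij_betw_same_card[symmetric])
  moreover have "card (SIGMA y1 : UNIV - {0 :: 'a}. UNIV - {0, y1\<^sup>2}) = (CARD('a) - 1) * (CARD('a) - 2)"
  proof -
    have "card (UNIV - {0, y1\<^sup>2}) = CARD('a) - 2" if "y1 \<noteq> 0" for y1 :: 'a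
      using that by (simp add: card_Diff_subset)
    then show ?thesis
      by (simp add: card_nonzero)
  qed
  ultimately show ?thesis
    by (simp add: card_cartesian_product card_nonzero power2_eq_square)
qed

lemma card_secant_params_even_values:
  fixes y :: "'a \<times> 'a \<times> 'a"
  assumes "y \<notin> conic_cone"
  shows "card (secant_params y) \<in> {0, CARD('a) - 2, CARD('a) - 4}"
  using assms by (cases y) (auto simp: card_secant_params_even)

lemma card_off_cone_max_even:
  assumes "CARD('a) \<ge> 7"
  shows "card (off_cone (CARD('a) - 2) :: ('a \<times> 'a \<times> 'a) set) = 3 * (CARD('a) - 1)\<^sup>2"
proof -
  obtain l where l: "CARD('a) = l + 7"
    using assms by (metis le_Suc_ex add.commute)
  have "distinct [0, CARD('a) - 2, CARD('a) - 4]"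
    using assms by auto
  then have "(\<Sum>k\<in>{0, CARD('a) - 2, CARD('a) - 4}. card (off_cone k :: ('a \<times> 'a \<times> 'a) set))
      = 3 * (CARD('a) - 1) + card (off_cone (CARD('a) - 2) :: ('a \<times> 'a \<times> 'a) set)
        + (CARD('a) - 1)\<^sup>2 * (CARD('a) - 2)"
    using card_off_cone_0_even[OF assms] card_off_cone_min_even[OF assms] by simp
  with sum_card_off_cone[OF _ card_secant_params_even_values]
  have "3 * (CARD('a) - 1) + card (off_cone (CARD('a) - 2) :: ('a \<times> 'a \<times> 'a) set)
      + (CARD('a) - 1)\<^sup>2 * (CARD('a) - 2) + (1 + (CARD('a) - 1)\<^sup>2) = CARD('a) ^ 3"
    by simp
  then show ?thesis
    unfolding l by (simp add: power3_eq_cube power2_eq_square algebra_simps)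
qed

end

section \<open>The code of the punctured conic\<close>

definition conic_syndrome :: "('n::finite \<Rightarrow> 'q) \<Rightarrow> ('n \<Rightarrow> 'q) \<Rightarrow> 'q::field ^ 'n \<Rightarrow> 'q \<times> 'q \<times> 'q" where
  "conic_syndrome lam t x =
    (\<Sum>j\<in>UNIV. lam j * x $ j, \<Sum>j\<in>UNIV. lam j * x $ j * t j, \<Sum>j\<in>UNIV. lam j * x $ j * (t j)\<^sup>2)"

lemma conic_syndrome_supported:
  assumes "supp x \<subseteq> S"
  shows "conic_syndrome lam t x =
    (\<Sum>j\<in>S. lam j * x $ j, \<Sum>j\<in>S. lam j * x $ j * t j, \<Sum>j\<in>S. lam j * x $ j * (t j)\<^sup>2)"
  unfolding conic_syndrome_def using assms
  by (auto simp: supp_def intro!: sum.mono_neutral_right)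

section \<open>Vandermonde systems\<close>

text \<open>The second assumption places \<open>(z0, z1, z2)\<close> in the plane of the two conic
  points. The value of \<open>b\<close> is recorded because its nonvanishing matters when weight 2
  vectors are constructed.\<close>

lemma vandermonde2_solvable:
  fixes u v z0 z1 z2 :: "'a::field"
  assumes "u \<noteq> v" "z2 - (u + v) * z1 + u * v * z0 = 0"
  obtains a b where "b = (z1 - u * z0) / (v - u)"
    "a + b = z0" "a * u + b * v = z1" "a * u\<^sup>2 + b * v\<^sup>2 = z2"
proof -
  define b where "b = (z1 - u * z0) / (v - u)"
  define a where "a = z0 - b"
  have "b * (v - u) = z1 - u * z0"
    using assms(1) by (simp add: b_def)
  then have 1: "a * u + b * v = z1"
    by (simp add: a_def algebra_simps)
  have "a * u\<^sup>2 + b * v\<^sup>2 = (u + v) * (a * u + b * v) - u * v * (a + b)"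
    by (simp add: power2_eq_square algebra_simps)
  also have "\<dots> = z2"
    using assms(2) 1 by (simp add: a_def algebra_simps)
  finally show thesis
    using 1 by (intro that[of b a]) (auto simp: b_def a_def)
qed

lemma vandermonde3_solvable:
  fixes u v w y0 y1 y2 :: "'a::field"
  assumes "u \<noteq> v" "u \<noteq> w" "v \<noteq> w"
  obtains a b c where "a + b + c = y0" "a * u + b * v + c * w = y1" "a * u\<^sup>2 + b * v\<^sup>2 + c * w\<^sup>2 = y2"
proof -
  \<comment> \<open>The form \<open>z2 - (u + v) * z1 + u * v * z0\<close> vanishes at the points of
    \<open>u\<close> and \<open>v\<close> and equals \<open>(w - u) * (w - v)\<close> at that of
    \<open>w\<close>, which forces this value.\<close>
  define c where "c = (y2 - (u + v) * y1 + u * v * y0) / ((w - u) * (w - v))"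
  have "c * ((w - u) * (w - v)) = y2 - (u + v) * y1 + u * v * y0"
    using assms by (simp add: c_def)
  then have "(y2 - c * w\<^sup>2) - (u + v) * (y1 - c * w) + u * v * (y0 - c) = 0"
    by (simp add: power2_eq_square algebra_simps)
  from vandermonde2_solvable[OF assms(1) this]
  obtain a b where "a + b = y0 - c" "a * u + b * v = y1 - c * w" "a * u\<^sup>2 + b * v\<^sup>2 = y2 - c * w\<^sup>2"
    by blast
  then show thesis
    by (intro that[of a b c]) auto
qed

lemma vandermonde3_kernel:
  fixes u v w a b c :: "'a::field"
  assumes "u \<noteq> v" "u \<noteq> w" "a + b + c = 0" "a * u + b * v + c * w = 0" "a * u\<^sup>2 + b * v\<^sup>2 + c * w\<^sup>2 = 0"
  shows "a = 0"
proof -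
  have "a * ((u - v) * (u - w)) = (a * u\<^sup>2 + b * v\<^sup>2 + c * w\<^sup>2) - (v + w) * (a * u + b * v + c * w)
      + v * w * (a + b + c)"
    by (simp add: power2_eq_square algebra_simps)
  with assms show ?thesis
    by simp
qed

section \<open>Chords and coset weights in normalized position\<close>

locale punctured_conic =
  fixes lam t :: "'n::finite \<Rightarrow> 'q::{field,finite}"
  assumes lam_nonzero: "lam j \<noteq> 0"
    and t_bij: "bij_betw t UNIV (UNIV - {0})"
    and CARD_ge_7: "CARD('q) \<ge> 7"
begin

lemma t_eq_iff [simp]: "t i = t j \<longleftrightarrow> i = j"
  using bij_betw_imp_inj_on[OF t_bij] by (auto dest: injD)

lemma t_nonzero [simp]: "t j \<noteq> 0"
  using bij_betw_imp_surj_on[OF t_bij] by auto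

lemma t_onto:
  assumes "u \<noteq> 0"
  obtains j where "t j = u"
  using bij_betw_imp_surj_on[OF t_bij] assms by (metis DiffI UNIV_I imageE singletonD)

lemma CARD_n: "CARD('n) = CARD('q) - 1"
  using bij_betw_same_card[OF t_bij] by (simp add: card_nonzero)

sublocale mds_syndrome "conic_syndrome lam t"
proof
  fix x y :: "'q ^ 'n"
  show "conic_syndrome lam t (x + y) = conic_syndrome lam t x + conic_syndrome lam t y"
    by (simp add: conic_syndrome_def algebra_simps sum.distrib)
next
  fix x :: "'q ^ 'n"
  assume x: "hamming_weight x \<le> 3" "conic_syndrome lam t x = 0"
  have "3 \<le> CARD('n)"
    using CARD_n CARD_ge_7 by simp
  \<comment> \<open>The support is enlarged to exactly three coordinates, so that lighter vectors
    need no separate treatment.\<close>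
  then obtain S where S: "supp x \<subseteq> S" "card S = 3"
    using exists_subset_between[of "supp x" 3 UNIV] x(1)
    by (auto simp: hamming_weight_eq_card_supp)
  have "x $ i = 0" if "i \<in> S" for i
  proof -
    have "card (S - {i}) = 2"
      using that S(2) by simp
    then obtain j k where jk: "S - {i} = {j, k}" "j \<noteq> k"
      by (auto simp: card_2_iff)
    then have S': "S = {i, j, k}" "i \<noteq> j" "i \<noteq> k"
      using that by auto
    have "lam i * x $ i = 0"
      by (rule vandermonde3_kernel[of "t i" "t j" "t k" _ "lam j * x $ j" "lam k * x $ k"])
         (use S' jk(2) x(2) conic_syndrome_supported[OF S(1), of lam t] in \<open>simp_all add: zero_prod_def add.assoc\<close>)
    then show ?thesis
      by (simp add: lam_nonzero)
  qed
  then show "x = 0"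
    using S(1) by (auto simp: vec_eq_iff supp_def)
next
  fix S :: "'n set" and y :: "'q \<times> 'q \<times> 'q"
  assume "card S = 3"
  then obtain i j k where S: "S = {i, j, k}" "i \<noteq> j" "i \<noteq> k" "j \<noteq> k"
    by (auto simp: card_3_iff)
  obtain y0 y1 y2 where y: "y = (y0, y1, y2)"
    by (cases y)
  have "t i \<noteq> t j" "t i \<noteq> t k" "t j \<noteq> t k"
    using S(2-4) by simp_all
  from vandermonde3_solvable[OF this, of y0 y1 y2]
  obtain a b c where abc: "a + b + c = y0" "a * t i + b * t j + c * t k = y1"
      "a * (t i)\<^sup>2 + b * (t j)\<^sup>2 + c * (t k)\<^sup>2 = y2"
    by blast
  define x where "x = (\<chi> l. if l = i then a / lam i else if l = j then b / lam j else if l = k then c / lam k else 0)"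
  have "supp x \<subseteq> S"
    by (auto simp: x_def S supp_def)
  moreover have "conic_syndrome lam t x = y"
    unfolding conic_syndrome_supported[OF \<open>supp x \<subseteq> S\<close>] using S(2-4) abc
    by (simp add: S(1) x_def y lam_nonzero add.assoc)
  ultimately show "\<exists>x. supp x \<subseteq> S \<and> conic_syndrome lam t x = y"
    by blast
next
  fix x :: "'q ^ 'n" and c :: 'q
  have "conic_syndrome lam t (c *s x) = (case conic_syndrome lam t x of (y0, y1, y2) \<Rightarrow> (c * y0, c * y1, c * y2))"
    by (simp add: conic_syndrome_def sum_distrib_left ac_simps)
  then show "conic_syndrome lam t x = 0 \<Longrightarrow> conic_syndrome lam t (c *s x) = 0"
    by (simp add: zero_prod_def)
next
  show "CARD('n) \<ge> 4"
    using CARD_n CARD_ge_7 by simp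
qed

lemma coset_weight_1_iff_conic_cone: "coset_weight (coset y) = 1 \<longleftrightarrow> y \<in> conic_cone"
proof
  assume "coset_weight (coset y) = 1"
  then obtain x where x: "hamming_weight x = 1" "conic_syndrome lam t x = y"
    using coset_weight_1_iff by blast
  then obtain j where j: "supp x = {j}"
    by (auto simp: hamming_weight_eq_card_supp card_1_singleton_iff)
  then have "x $ j \<noteq> 0"
    by (auto simp: supp_def)
  then show "y \<in> conic_cone"
    using x(2) j conic_syndrome_supported[of x "{j}" lam t]
    by (auto simp: lam_nonzero power2_eq_square)
next
  assume "y \<in> conic_cone"
  then obtain y0 y1 y2 where y: "y = (y0, y1, y2)" "y0 \<noteq> 0" "y1 \<noteq> 0" "y1\<^sup>2 = y0 * y2"
    by (cases y) auto
  then obtain j where j: "t j = y1 / y0"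
    using t_onto[of "y1 / y0"] by auto
  define x where "x = axis j (y0 / lam j)"
  have supp: "supp x = {j}"
    using y lam_nonzero by (auto simp: x_def supp_def axis_def)
  have "y2 = y0 * (t j)\<^sup>2"
    using y by (simp add: j power2_eq_square field_simps)
  then have "conic_syndrome lam t x = y"
    using conic_syndrome_supported[of x "{j}" lam t] supp y lam_nonzero[of j]
    by (simp add: x_def j)
  moreover have "hamming_weight x = 1"
    by (simp add: hamming_weight_eq_card_supp supp)
  ultimately show "coset_weight (coset y) = 1"
    using coset_weight_1_iff by blast
qed

text \<open>Each weight 2 vector of the coset is counted once for each of its two nonzero coordinates.\<close>

lemma two_num_weight_2:
  assumes "y \<notin> conic_cone"
  shows "2 * num_weight (coset y) 2 = int (card (secant_params y))"
proof -
  define X where "X = {x \<in> coset y. hamming_weight x = 2}"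
  obtain y0 y1 y2 where y: "y = (y0, y1, y2)"
    by (cases y)
  have "card (SIGMA x : X. supp x) = 2 * card X"
    by (simp add: X_def hamming_weight_eq_card_supp)
  moreover have "bij_betw (\<lambda>(x, i). t i) (SIGMA x : X. supp x) (secant_params y)"
    unfolding bij_betw_def
  proof
    show "inj_on (\<lambda>(x, i). t i) (SIGMA x : X. supp x)"
    proof (rule inj_onI, clarsimp)
      fix x x' i assume x: "x \<in> X" "x' \<in> X" "i \<in> supp x" "i \<in> supp x'"
      \<comment> \<open>Two vectors of weight 2 sharing a nonzero coordinate differ in at most three
        places, hence agree if they have the same syndrome.\<close>
      have "card (supp x \<union> supp x') + card (supp x \<inter> supp x') = 4"
        using card_Un_Int[of "supp x" "supp x'"] x by (simp add: X_def hamming_weight_eq_card_supp)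
      moreover have "card (supp x \<inter> supp x') > 0"
        using x by (auto simp: card_gt_0_iff)
      ultimately have "card (supp x \<union> supp x') \<le> 3"
        by linarith
      then have "hamming_weight (x - x') \<le> 3"
        unfolding hamming_weight_eq_card_supp
        using card_mono[OF _ supp_diff_subset[of x x']] by simp
      then show "x = x'"
        using syn_eq_0[of "x - x'"] x by (simp add: X_def coset_def syn_diff)
    qed
  next
    show "(\<lambda>(x, i). t i) ` (SIGMA x : X. supp x) = secant_params y"
    proof (intro subset_antisym subsetI)
      fix u assume "u \<in> (\<lambda>(x, i). t i) ` (SIGMA x : X. supp x)"
      then obtain x i where xi: "x \<in> X" "i \<in> supp x" "u = t i"
        by auto
      then have "card (supp x - {i}) = 1"
        by (simp add: X_def hamming_weight_eq_card_supp)
      then obtain j where "supp x - {i} = {j}"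
        by (auto simp: card_1_singleton_iff)
      then have j: "supp x = {i, j}" "i \<noteq> j"
        using xi(2) by auto
      define a where "a = lam i * x $ i"
      define b where "b = lam j * x $ j"
      have "x $ j \<noteq> 0"
        using j by (auto simp: supp_def)
      then have b: "b \<noteq> 0"
        by (simp add: b_def lam_nonzero)
      have y': "y0 = a + b" "y1 = a * t i + b * t j" "y2 = a * (t i)\<^sup>2 + b * (t j)\<^sup>2"
        using xi(1) conic_syndrome_supported[of x "{i, j}" lam t] j
        by (simp_all add: X_def coset_def y a_def b_def)
      have "t i * y0 - y1 = b * (t i - t j)" "t i * y1 - y2 = b * t j * (t i - t j)"
          "(t i)\<^sup>2 * y0 - 2 * t i * y1 + y2 = b * (t i - t j)\<^sup>2"
        by (simp_all add: y' power2_eq_square algebra_simps)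
      then have "t i * y0 - y1 \<noteq> 0" "t i * y1 - y2 \<noteq> 0" "(t i)\<^sup>2 * y0 - 2 * t i * y1 + y2 \<noteq> 0"
        using b j(2) by simp_all
      then show "u \<in> secant_params y"
        by (auto simp: secant_params_def y xi(3))
    next
      fix u assume "u \<in> secant_params y"
      then have u: "u \<noteq> 0" "u * y0 \<noteq> y1" "u * y1 \<noteq> y2" "u\<^sup>2 * y0 - 2 * u * y1 + y2 \<noteq> 0"
        by (auto simp: secant_params_def y)
      \<comment> \<open>The parameter of the second point in which the line through \<open>y\<close>
        and the point of \<open>u\<close> meets the conic.\<close>
      define v where "v = (u * y1 - y2) / (u * y0 - y1)"
      have v: "v * (u * y0 - y1) = u * y1 - y2"
        using u by (simp add: v_def)
      have "v \<noteq> 0"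
        using u by (simp add: v_def)
      have "u * (u * y0 - y1) - (u * y1 - y2) = u\<^sup>2 * y0 - 2 * u * y1 + y2"
        by (simp add: power2_eq_square algebra_simps)
      then have "u \<noteq> v"
        using u(4) v by (metis right_minus_eq)
      obtain i where i: "t i = u"
        using t_onto[OF u(1)] by blast
      obtain j where j: "t j = v"
        using t_onto[OF \<open>v \<noteq> 0\<close>] by blast
      have "i \<noteq> j"
        using i j \<open>u \<noteq> v\<close> by auto
      have "y2 - (u + v) * y1 + u * v * y0 = 0"
        using v by (simp add: algebra_simps)
      from vandermonde2_solvable[OF \<open>u \<noteq> v\<close> this]
      obtain a b where ab: "b = (y1 - u * y0) / (v - u)" "a + b = y0" "a * u + b * v = y1"
          "a * u\<^sup>2 + b * v\<^sup>2 = y2"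
        by blast
      have "b \<noteq> 0"
        using u \<open>u \<noteq> v\<close> by (simp add: ab(1))
      \<comment> \<open>Otherwise \<open>y\<close> would be a multiple of the single column with
        parameter \<open>v\<close>.\<close>
      have "a \<noteq> 0"
      proof
        assume "a = 0"
        then have "y \<in> conic_cone"
          using ab(2-4) \<open>b \<noteq> 0\<close> \<open>v \<noteq> 0\<close> by (auto simp: y power2_eq_square)
        with assms show False
          by contradiction
      qed
      define x where "x = (\<chi> l. if l = i then a / lam i else if l = j then b / lam j else 0)"
      have supp: "supp x = {i, j}"
        using \<open>a \<noteq> 0\<close> \<open>b \<noteq> 0\<close> lam_nonzero by (auto simp: x_def supp_def)
      have "conic_syndrome lam t x = y"
        unfolding conic_syndrome_supported[OF eq_refl[OF supp]]
        using ab(2-4) \<open>i \<noteq> j\<close> i j by (simp add: x_def y lam_nonzero)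
      then have "x \<in> X"
        using supp \<open>i \<noteq> j\<close> by (simp add: X_def coset_def hamming_weight_eq_card_supp)
      then show "u \<in> (\<lambda>(x, i). t i) ` (SIGMA x : X. supp x)"
        using i supp by (auto intro!: image_eqI[of _ _ "(x, i)"])
    qed
  qed
  ultimately have "card (secant_params y) = 2 * card X"
    using bij_betw_same_card by fastforce
  then show ?thesis
    by (simp add: num_weight_def X_def)
qed

lemma coset_weight_2_with_num:
  assumes "i > 0"
  shows "{y. coset_weight (coset y) = 2 \<and> num_weight (coset y) 2 = int i} = off_cone (2 * i)"
proof -
  have "coset_weight (coset y) = 2 \<and> num_weight (coset y) 2 = int i \<longleftrightarrow> y \<in> off_cone (2 * i)" for y
  proof (cases "y \<in> conic_cone")
    case True
    then have "coset_weight (coset y) = 1"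
      by (simp only: coset_weight_1_iff_conic_cone)
    with True show ?thesis
      by (simp add: off_cone_def)
  next
    case False
    then have "num_weight (coset y) 2 = int i \<longleftrightarrow> card (secant_params y) = 2 * i"
      using two_num_weight_2[OF False] by linarith
    moreover have "coset_weight (coset y) \<noteq> 1"
      using False coset_weight_1_iff_conic_cone by blast
    moreover have "coset_weight (coset y) = 2" if "num_weight (coset y) 2 = int i" "y \<noteq> 0"
    proof -
      have "coset_weight (coset y) \<noteq> 0"
        using that by (simp add: coset_weight_eq_0_iff)
      moreover have "num_weight (coset y) 2 \<noteq> 0"
        using that(1) assms by simp
      then obtain x where "conic_syndrome lam t x = y" "hamming_weight x = 2"
        using num_weight_coset_eq_0_iff by blast
      then have "coset_weight (coset y) \<le> 2"
        using coset_weight_le[of x] by simp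
      ultimately show ?thesis
        using \<open>coset_weight (coset y) \<noteq> 1\<close> by linarith
    qed
    ultimately show ?thesis
      using False coset_weight_eq_0_iff[of y] by (auto simp: off_cone_def)
  qed
  then show ?thesis
    by blast
qed

lemma coset_weight_2_off_cone:
  assumes "coset_weight (coset y) = 2"
  shows "y \<notin> conic_cone" "card (secant_params y) \<noteq> 0"
proof -
  show *: "y \<notin> conic_cone"
    using assms coset_weight_1_iff_conic_cone[of y] by auto
  show "card (secant_params y) \<noteq> 0"
    using assms two_num_weight_2[OF *] coset_weight_eq_iff[of y 2] by auto
qed

text \<open>Off the cone a nonzero syndrome has coset weight 2 or 3, and it is 3 exactly when there
  is no vector of weight 2.\<close>

lemma coset_weight_3_eq: "{y. coset_weight (coset y) = 3} = off_cone 0"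
proof -
  have "coset_weight (coset y) = 3 \<longleftrightarrow> y \<in> off_cone 0" for y
  proof -
    have "coset_weight (coset y) \<in> {0, 1, 2, 3}"
      using coset_weight_le_3[of y] by auto
    moreover have "card (secant_params y) = 0 \<longleftrightarrow> num_weight (coset y) 2 = 0" if "y \<notin> conic_cone"
      using two_num_weight_2[OF that] by linarith
    moreover have "num_weight (coset y) 2 \<noteq> 0" if "coset_weight (coset y) = 2"
      using that coset_weight_eq_iff by blast
    moreover have "num_weight (coset y) 2 = 0" if "coset_weight (coset y) = 3"
      using that coset_weight_eq_iff[of y 3] by auto
    ultimately show ?thesis
      using coset_weight_eq_0_iff[of y] coset_weight_1_iff_conic_cone[of y]
      by (auto simp: off_cone_def simp del: card_eq_0_iff card_0_eq)
  qed
  then show ?thesis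
    by blast
qed

lemma card_D2_class_off_cone:
  "i > 0 \<Longrightarrow> card (D2_class (coset 0) i) = card (off_cone (2 * i) :: ('q \<times> 'q \<times> 'q) set)"
  by (simp add: card_D2_class coset_weight_2_with_num)

lemma card_weight_1_cosets: "card (cosets_of_weight (coset 0) 1) = (CARD('q) - 1)\<^sup>2"
  unfolding card_cosets_of_weight coset_weight_1_iff_conic_cone by (simp add: card_conic_cone)

lemma card_weight_3_cosets:
  "card (cosets_of_weight (coset 0) 3) = card (off_cone 0 :: ('q \<times> 'q \<times> 'q) set)"
  unfolding card_cosets_of_weight coset_weight_3_eq ..

text \<open>Blocks with different \<open>i\<close> are disjoint because \<open>i\<close> is the
  number of vectors of weight 2. The assumption \<open>ne\<close> makes every block nonempty, as
  \<open>partition_on\<close> demands.\<close>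

lemma partition_weight_2_cosets:
  assumes "0 \<notin> I"
    and vals: "\<And>y :: 'q \<times> 'q \<times> 'q. y \<notin> conic_cone \<Longrightarrow> card (secant_params y) \<noteq> 0 \<Longrightarrow>
      \<exists>i\<in>I. card (secant_params y) = 2 * i"
    and ne: "\<And>i. i \<in> I \<Longrightarrow> card (off_cone (2 * i) :: ('q \<times> 'q \<times> 'q) set) \<noteq> 0"
  shows "partition_on (cosets_of_weight (coset 0) 2) (D2_class (coset 0) ` I)"
proof (rule partition_onI)
  have "\<exists>i\<in>I. V \<in> D2_class (coset 0) i" if V: "V \<in> cosets_of_weight (coset 0) 2" for V
  proof -
    obtain y where y: "V = coset y" "coset_weight (coset y) = 2"
      using V unfolding cosets_of_weight_eq by blast
    from vals[OF coset_weight_2_off_cone[OF y(2)]] obtain i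
      where i: "i \<in> I" "card (secant_params y) = 2 * i"
      by blast
    then have "num_weight (coset y) 2 = int i"
      using two_num_weight_2[OF coset_weight_2_off_cone(1)[OF y(2)]] by simp
    with y i(1) show ?thesis
      by (auto simp: D2_class_eq)
  qed
  then show "\<Union> (D2_class (coset 0) ` I) = cosets_of_weight (coset 0) 2"
    by (auto simp: D2_class_def)
next
  fix p r assume "p \<in> D2_class (coset 0) ` I" "r \<in> D2_class (coset 0) ` I" "p \<noteq> r"
  then show "disjnt p r"
    by (auto simp: disjnt_iff D2_class_def distr_D2_def Let_def)
next
  show "{} \<notin> D2_class (coset 0) ` I"
  proof
    assume "{} \<in> D2_class (coset 0) ` I"
    then obtain i where i: "i \<in> I" "D2_class (coset 0) i = {}"
      by (metis imageE)
    then have "i > 0"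
      using assms(1) by (metis gr0I)
    then show False
      using card_D2_class_off_cone[of i] ne[OF i(1)] i(2) by simp
  qed
qed

end

section \<open>Change of coordinates on the projective line\<close>

text \<open>Homogeneous coordinates \<open>(x, y)\<close> in which the conic is the Veronese image
  \<open>(x\<^sup>2, x * y, y\<^sup>2)\<close>, without a special case for infinity.\<close>

fun proj_x :: "'q::field option \<Rightarrow> 'q" where
  "proj_x (Some t) = 1"
| "proj_x None = 0"

fun proj_y :: "'q::field option \<Rightarrow> 'q" where
  "proj_y (Some t) = t"
| "proj_y None = 1"

definition proj_det :: "'q::field option \<Rightarrow> 'q option \<Rightarrow> 'q" where
  "proj_det R S = proj_x R * proj_y S - proj_y R * proj_x S"

lemma conic_point_proj:
  "conic_point R $ 1 = proj_x R * proj_x R" "conic_point R $ 2 = proj_x R * proj_y R"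
  "conic_point R $ 3 = proj_y R * proj_y R"
  by (cases R; simp add: vector_3 power2_eq_square)+

lemma proj_det_eq_0_iff [simp]: "proj_det R S = 0 \<longleftrightarrow> R = S"
  by (cases R; cases S) (auto simp: proj_det_def)

lemma proj_det_pluecker:
  "proj_det P R * proj_det Q S - proj_det P S * proj_det Q R = proj_det P Q * proj_det R S"
  by (simp add: proj_det_def algebra_simps)

text \<open>A linear substitution in \<open>X\<close> and \<open>Y\<close> preserves the three
  parity checks, since the new quadratic monomials are combinations of the old ones.\<close>

lemma sum_quadratic_vanishes:
  fixes w X Y :: "'n \<Rightarrow> 'q::comm_ring_1"
  assumes "(\<Sum>j\<in>A. w j * (X j * X j)) = 0" "(\<Sum>j\<in>A. w j * (X j * Y j)) = 0"
    "(\<Sum>j\<in>A. w j * (Y j * Y j)) = 0"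
  shows "(\<Sum>j\<in>A. w j * ((a * X j + b * Y j) * (c * X j + d * Y j))) = 0"
proof -
  have "(\<Sum>j\<in>A. w j * ((a * X j + b * Y j) * (c * X j + d * Y j)))
      = (\<Sum>j\<in>A. (a * c) * (w j * (X j * X j)) + (a * d + b * c) * (w j * (X j * Y j))
          + (b * d) * (w j * (Y j * Y j)))"
    by (intro sum.cong refl) (simp add: algebra_simps)
  also have "\<dots> = 0"
    by (simp only: sum.distrib sum_distrib_left[symmetric] assms) simp
  finally show ?thesis .
qed

text \<open>The linear forms vanishing at \<open>P\<close> and at \<open>Q\<close> are coordinates on the projective line
  in which the two removed points are \<open>0\<close> and \<open>\<infinity>\<close>.\<close>

lemma punctured_conic_coordinates:
  fixes s :: "'q::{field,finite} option \<Rightarrow> 'q" and \<sigma> :: "'n::finite \<Rightarrow> 'q option"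
  assumes "CARD('q) \<ge> 7" "\<And>R. s R \<noteq> 0" "P \<noteq> Q" "bij_betw \<sigma> UNIV (UNIV - {P, Q})"
  obtains lam t where "punctured_conic lam t"
    "code_of_parity_check (select_columns \<sigma> (conic_matrix s)) = {x. conic_syndrome lam t x = 0}"
proof -
  have \<sigma>: "\<sigma> j \<noteq> P" "\<sigma> j \<noteq> Q" for j
    using bij_betw_imp_surj_on[OF assms(4)] by auto
  define X where "X j = proj_x (\<sigma> j)" for j
  define Y where "Y j = proj_y (\<sigma> j)" for j
  define F where "F j = proj_det P (\<sigma> j)" for j
  define G where "G j = proj_det Q (\<sigma> j)" for j
  define \<delta> where "\<delta> = proj_det P Q"
  have FG: "F j \<noteq> 0" "G j \<noteq> 0" for j
    using \<sigma>[of j] by (auto simp: F_def G_def)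
  have \<delta>: "\<delta> \<noteq> 0"
    using assms(3) by (simp add: \<delta>_def)
  have F: "F j = (- proj_y P) * X j + proj_x P * Y j" for j
    by (simp add: F_def X_def Y_def proj_det_def)
  have G: "G j = (- proj_y Q) * X j + proj_x Q * Y j" for j
    by (simp add: G_def X_def Y_def proj_det_def)
  \<comment> \<open>Cramer's rule inverts the substitution up to the nonzero determinant
    \<open>\<delta>\<close>.\<close>
  have X: "\<delta> * X j = proj_x Q * F j + (- proj_x P) * G j" for j
    by (simp add: F G \<delta>_def proj_det_def algebra_simps)
  have Y: "\<delta> * Y j = proj_y Q * F j + (- proj_y P) * G j" for j
    by (simp add: F G \<delta>_def proj_det_def algebra_simps)
  \<comment> \<open>Pulling \<open>(G j)\<^sup>2\<close> out of the column
    \<open>(G\<^sup>2, F * G, F\<^sup>2)\<close> leaves \<open>(1, t, t\<^sup>2)\<close> with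
    \<open>t = F / G\<close>.\<close>
  define lam where "lam j = s (\<sigma> j) * (G j)\<^sup>2" for j
  define t where "t j = F j / G j" for j
  have "inj t"
  proof (rule injI)
    fix i j assume "t i = t j"
    then have "F i * G j - F j * G i = 0"
      using FG by (simp add: t_def field_simps)
    \<comment> \<open>The Pluecker relation turns equality of the ratios into vanishing of the
      determinant of the two points.\<close>
    then have "\<delta> * proj_det (\<sigma> i) (\<sigma> j) = 0"
      unfolding F_def G_def \<delta>_def proj_det_pluecker .
    then have "\<sigma> i = \<sigma> j"
      using \<delta> by simp
    then show "i = j"
      using bij_betw_imp_inj_on[OF assms(4)] by (simp add: injD)
  qed
  moreover have "CARD('n) = CARD('q) - 1"
    using bij_betw_same_card[OF assms(4)] assms(3) by (simp add: card_Diff_subset card_UNIV_option)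
  then have "card (range t) = card (UNIV - {0 :: 'q})"
    using \<open>inj t\<close> by (simp add: card_image card_nonzero)
  then have "range t = UNIV - {0}"
    using FG by (intro card_subset_eq) (auto simp: t_def)
  ultimately have "punctured_conic lam t"
    using assms(1,2) FG by unfold_locales (auto simp: bij_betw_def lam_def)
  moreover have "select_columns \<sigma> (conic_matrix s) *v x = 0 \<longleftrightarrow> conic_syndrome lam t x = 0" for x
  proof -
    define w where "w j = s (\<sigma> j) * x $ j" for j
    have H: "select_columns \<sigma> (conic_matrix s) *v x = 0 \<longleftrightarrow> (\<Sum>j\<in>UNIV. w j * (X j * X j)) = 0 \<and>
        (\<Sum>j\<in>UNIV. w j * (X j * Y j)) = 0 \<and> (\<Sum>j\<in>UNIV. w j * (Y j * Y j)) = 0"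
      by (simp add: vec_eq_iff forall_3 matrix_vector_mult_def select_columns_def conic_matrix_def
          conic_point_proj w_def X_def Y_def ac_simps)
    have "(\<Sum>j\<in>UNIV. lam j * x $ j) = (\<Sum>j\<in>UNIV. w j * (G j * G j))"
      "(\<Sum>j\<in>UNIV. lam j * x $ j * t j) = (\<Sum>j\<in>UNIV. w j * (F j * G j))"
      "(\<Sum>j\<in>UNIV. lam j * x $ j * (t j)\<^sup>2) = (\<Sum>j\<in>UNIV. w j * (F j * F j))"
      using FG by (auto simp: lam_def w_def t_def power2_eq_square intro!: sum.cong)
    then have K: "conic_syndrome lam t x = 0 \<longleftrightarrow> (\<Sum>j\<in>UNIV. w j * (F j * F j)) = 0 \<and>
        (\<Sum>j\<in>UNIV. w j * (F j * G j)) = 0 \<and> (\<Sum>j\<in>UNIV. w j * (G j * G j)) = 0"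
      by (auto simp: conic_syndrome_def zero_prod_def)
    show ?thesis
      unfolding H K
    proof
      assume "(\<Sum>j\<in>UNIV. w j * (X j * X j)) = 0 \<and> (\<Sum>j\<in>UNIV. w j * (X j * Y j)) = 0 \<and>
        (\<Sum>j\<in>UNIV. w j * (Y j * Y j)) = 0"
      then show "(\<Sum>j\<in>UNIV. w j * (F j * F j)) = 0 \<and>
        (\<Sum>j\<in>UNIV. w j * (F j * G j)) = 0 \<and> (\<Sum>j\<in>UNIV. w j * (G j * G j)) = 0"
        unfolding F G by (intro conjI sum_quadratic_vanishes) auto
    next
      assume "(\<Sum>j\<in>UNIV. w j * (F j * F j)) = 0 \<and>
        (\<Sum>j\<in>UNIV. w j * (F j * G j)) = 0 \<and> (\<Sum>j\<in>UNIV. w j * (G j * G j)) = 0"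
      then have FG0: "(\<Sum>j\<in>UNIV. w j * (F j * F j)) = 0"
        "(\<Sum>j\<in>UNIV. w j * (F j * G j)) = 0" "(\<Sum>j\<in>UNIV. w j * (G j * G j)) = 0"
        by blast+
      have "(\<Sum>j\<in>UNIV. w j * ((\<delta> * X j) * (\<delta> * X j))) = 0"
        "(\<Sum>j\<in>UNIV. w j * ((\<delta> * X j) * (\<delta> * Y j))) = 0"
        "(\<Sum>j\<in>UNIV. w j * ((\<delta> * Y j) * (\<delta> * Y j))) = 0"
        unfolding X Y by (rule sum_quadratic_vanishes[OF FG0])+
      moreover have "w j * ((\<delta> * U) * (\<delta> * V)) = \<delta>\<^sup>2 * (w j * (U * V))" for j U V
        by (simp add: power2_eq_square)
      ultimately show "(\<Sum>j\<in>UNIV. w j * (X j * X j)) = 0 \<and>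
        (\<Sum>j\<in>UNIV. w j * (X j * Y j)) = 0 \<and> (\<Sum>j\<in>UNIV. w j * (Y j * Y j)) = 0"
        using \<delta> by (simp flip: sum_distrib_left)
    qed
  qed
  ultimately show thesis
    using that by (simp add: code_of_parity_check_def)
qed

section \<open>Assembling the two parities\<close>

context punctured_conic
begin

lemma covering_radius_punctured:
  assumes "card (off_cone 0 :: ('q \<times> 'q \<times> 'q) set) \<noteq> 0"
  shows "covering_radius (coset 0) = 3"
proof -
  obtain y where "y \<in> (off_cone 0 :: ('q \<times> 'q \<times> 'q) set)"
    using assms by (metis card.empty ex_in_conv)
  then show ?thesis
    using covering_radius_code coset_weight_3_eq by blast
qed

lemma weight_2_3_cosets_odd:
  assumes "odd CARD('q)" and q: "q = CARD('q)"
  shows "covering_radius (coset 0) = 3 \<and> partition_on (cosets_of_weight (coset 0) 2)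
       {D2_class (coset 0) ((q - 1) div 2), D2_class (coset 0) ((q - 3) div 2), D2_class (coset 0) ((q - 5) div 2)}
     \<and> card (D2_class (coset 0) ((q - 1) div 2)) = (q - 1) * ((q + 1) div 2)
     \<and> card (D2_class (coset 0) ((q - 3) div 2)) = (q - 1) * ((q - 1) * (q + 4) div 2)
     \<and> card (D2_class (coset 0) ((q - 5) div 2)) = (q - 1) * ((q - 1) * (q - 3) div 2)
     \<and> card (cosets_of_weight (coset 0) 3) = 2 * (q - 1)"
proof -
  define m where "m = CARD('q) div 2"
  have card_eq: "CARD('q) = 2 * m + 1"
    using assms(1) by (simp add: m_def)
  have m: "m \<ge> 3"
    using CARD_ge_7 card_eq by simp
  have odd_char: "(2 :: 'q) \<noteq> 0"
    using assms(1) odd_CARD_iff by blast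
  have div: "(q - 1) div 2 = m" "(q - 3) div 2 = m - 1" "(q - 5) div 2 = m - 2"
    using m by (simp_all add: q card_eq)
  have double: "2 * (m - 1) = 2 * m - 2" "2 * (m - 2) = 2 * m - 4"
    by simp_all
  note off = card_off_cone_0_odd[OF odd_char card_eq m] card_off_cone_max_odd[OF odd_char card_eq m]
    card_off_cone_mid_odd[OF odd_char card_eq m] card_off_cone_min_odd[OF odd_char card_eq m]
  have part: "partition_on (cosets_of_weight (coset 0) 2) (D2_class (coset 0) ` {m, m - 1, m - 2})"
  proof (rule partition_weight_2_cosets)
    show "0 \<notin> {m, m - 1, m - 2}"
      using m by auto
    show "\<exists>i\<in>{m, m - 1, m - 2}. card (secant_params y) = 2 * i"
      if "y \<notin> conic_cone" "card (secant_params y) \<noteq> 0" for y :: "'q \<times> 'q \<times> 'q"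
      using card_secant_params_odd_values[OF odd_char card_eq that(1)] that(2) by auto
    show "card (off_cone (2 * i) :: ('q \<times> 'q \<times> 'q) set) \<noteq> 0" if "i \<in> {m, m - 1, m - 2}" for i
      using that m off double by auto
  qed
  have q': "q - 1 = 2 * m" "q - 3 = 2 * (m - 1)" "q + 1 = 2 * (m + 1)" "q + 4 = 2 * m + 5"
    by (simp_all add: q card_eq)
  have "card (D2_class (coset 0) m) = (q - 1) * ((q + 1) div 2)"
    using m unfolding q' by (simp add: card_D2_class_off_cone off)
  moreover have "card (D2_class (coset 0) (m - 1)) = (q - 1) * ((q - 1) * (q + 4) div 2)"
    using m card_D2_class_off_cone[of "m - 1"] off(3) double(1) unfolding q' by simp
  moreover have "card (D2_class (coset 0) (m - 2)) = (q - 1) * ((q - 1) * (q - 3) div 2)"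
    using m card_D2_class_off_cone[of "m - 2"] off(4) double(2) unfolding q' by simp
  moreover have "covering_radius (coset 0) = 3"
    using off(1) m by (intro covering_radius_punctured) simp
  moreover have "card (cosets_of_weight (coset 0) 3) = 2 * (q - 1)"
    unfolding q' by (simp add: card_weight_3_cosets off(1))
  ultimately show ?thesis
    using part unfolding div image_insert image_empty by blast
qed

lemma weight_2_3_cosets_even:
  assumes "even CARD('q)" and q: "q = CARD('q)"
  shows "covering_radius (coset 0) = 3 \<and> partition_on (cosets_of_weight (coset 0) 2)
       {D2_class (coset 0) ((q - 2) div 2), D2_class (coset 0) ((q - 4) div 2)}
     \<and> card (D2_class (coset 0) ((q - 2) div 2)) = 3 * (q - 1)\<^sup>2
     \<and> card (D2_class (coset 0) ((q - 4) div 2)) = (q - 1)\<^sup>2 * (q - 2)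
     \<and> card (cosets_of_weight (coset 0) 3) = 3 * (q - 1)"
proof -
  have char_2: "(2 :: 'q) = 0"
    using assms(1) odd_CARD_iff by blast
  have double: "2 * ((q - 2) div 2) = CARD('q) - 2" "2 * ((q - 4) div 2) = CARD('q) - 4"
    using assms CARD_ge_7 by auto
  note off = card_off_cone_0_even[OF char_2 CARD_ge_7] card_off_cone_max_even[OF char_2 CARD_ge_7]
    card_off_cone_min_even[OF char_2 CARD_ge_7]
  have pos: "(q - 2) div 2 > 0" "(q - 4) div 2 > 0"
    using CARD_ge_7 q by auto
  have "partition_on (cosets_of_weight (coset 0) 2) (D2_class (coset 0) ` {(q - 2) div 2, (q - 4) div 2})"
  proof (rule partition_weight_2_cosets)
    show "0 \<notin> {(q - 2) div 2, (q - 4) div 2}"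
      using pos by auto
    show "\<exists>i\<in>{(q - 2) div 2, (q - 4) div 2}. card (secant_params y) = 2 * i"
      if "y \<notin> conic_cone" "card (secant_params y) \<noteq> 0" for y :: "'q \<times> 'q \<times> 'q"
    proof -
      have "card (secant_params y) = CARD('q) - 2 \<or> card (secant_params y) = CARD('q) - 4"
        using card_secant_params_even_values[OF char_2 that(1)] that(2) by auto
      then show ?thesis
        unfolding double[symmetric] by blast
    qed
    show "card (off_cone (2 * i) :: ('q \<times> 'q \<times> 'q) set) \<noteq> 0" if "i \<in> {(q - 2) div 2, (q - 4) div 2}" for i
    proof -
      have "card (off_cone (2 * ((q - 2) div 2)) :: ('q \<times> 'q \<times> 'q) set) \<noteq> 0"
        unfolding double off(2) using CARD_ge_7 by simp
      moreover have "card (off_cone (2 * ((q - 4) div 2)) :: ('q \<times> 'q \<times> 'q) set) \<noteq> 0"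
        unfolding double off(3) using CARD_ge_7 by simp
      ultimately show ?thesis
        using that by blast
    qed
  qed
  moreover have "card (D2_class (coset 0) ((q - 2) div 2)) = 3 * (q - 1)\<^sup>2"
    "card (D2_class (coset 0) ((q - 4) div 2)) = (q - 1)\<^sup>2 * (q - 2)"
    unfolding card_D2_class_off_cone[OF pos(1)] card_D2_class_off_cone[OF pos(2)] double
    using off(2,3) by (simp_all add: q)
  moreover have "covering_radius (coset 0) = 3"
    using off(1) CARD_ge_7 by (intro covering_radius_punctured) simp
  ultimately show ?thesis
    using off(1) by (simp add: card_weight_3_cosets q)
qed

lemma linear_code_punctured: "linear_code (CARD('q) - 1) (CARD('q) - 1 - 3) 4 (coset 0)"
  using subspace_code dim_code min_distance_code CARD_n by (simp add: linear_code_def)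

end

theorem theorem6p10:
  fixes s :: "'q::{field,finite} option \<Rightarrow> 'q"
    and P Q :: "'q option"
    and \<sigma> :: "'n::finite \<Rightarrow> 'q option"
    and C :: "('q ^ 'n) set"
    and q n :: nat
  assumes "q = CARD('q)" and "q \<ge> 7" and "n = q - 1"
    and "\<And>R. s R \<noteq> 0"
    and "P \<noteq> Q"
    and "bij_betw \<sigma> UNIV (UNIV - {P, Q})"
    and "C = code_of_parity_check (select_columns \<sigma> (conic_matrix s))"
  shows "linear_code n (n - 3) 4 C
    \<and> covering_radius C = 3
    \<and> card (cosets_of_weight C 1) = (q - 1)\<^sup>2
    \<and> (\<forall>V\<in>cosets_of_weight C 1. distr_D1 C V)
    \<and> (odd q \<longrightarrow>
         partition_on (cosets_of_weight C 2)
           {D2_class C ((q - 1) div 2), D2_class C ((q - 3) div 2), D2_class C ((q - 5) div 2)}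
       \<and> card (D2_class C ((q - 1) div 2)) = (q - 1) * ((q + 1) div 2)
       \<and> card (D2_class C ((q - 3) div 2)) = (q - 1) * ((q - 1) * (q + 4) div 2)
       \<and> card (D2_class C ((q - 5) div 2)) = (q - 1) * ((q - 1) * (q - 3) div 2)
       \<and> card (cosets_of_weight C 3) = 2 * (q - 1)
       \<and> (\<forall>V\<in>cosets_of_weight C 3. distr_D3 C V))
    \<and> (even q \<longrightarrow>
         partition_on (cosets_of_weight C 2)
           {D2_class C ((q - 2) div 2), D2_class C ((q - 4) div 2)}
       \<and> card (D2_class C ((q - 2) div 2)) = 3 * (q - 1)\<^sup>2
       \<and> card (D2_class C ((q - 4) div 2)) = (q - 1)\<^sup>2 * (q - 2)
       \<and> card (cosets_of_weight C 3) = 3 * (q - 1)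
       \<and> (\<forall>V\<in>cosets_of_weight C 3. distr_D3 C V))
    \<and> (\<forall>i j. i \<noteq> j \<longrightarrow> (\<forall>Va\<in>D2_class C i. \<forall>Vb\<in>D2_class C j. \<forall>w\<in>{3..n}.
         (-1) ^ n * num_weight Va w - num_weight Va (n + 2 - w)
         = (-1) ^ n * num_weight Vb w - num_weight Vb (n + 2 - w)))"
proof -
  have "CARD('q) \<ge> 7"
    using assms(1,2) by simp
  then obtain lam t where "punctured_conic lam t"
      "code_of_parity_check (select_columns \<sigma> (conic_matrix s)) = {x. conic_syndrome lam t x = 0}"
    \<comment> \<open>Only the kernel of the parity check matrix matters, so \<open>C\<close> may be
      treated as the code with \<open>0\<close> and \<open>\<infinity>\<close> removed.\<close>
    by (rule punctured_conic_coordinates[OF _ assms(4-6)])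
  note C_eq = assms(7)[unfolded this(2)]
  interpret punctured_conic lam t
    by fact
  have C: "C = coset 0"
    by (simp add: C_eq coset_def)
  have n: "n = CARD('n)"
    using assms(1,3) CARD_n by simp
  have "linear_code n (n - 3) 4 C"
    using linear_code_punctured assms(1,3) C by simp
  moreover have "covering_radius C = 3"
    using weight_2_3_cosets_odd weight_2_3_cosets_even unfolding C by blast
  moreover have "card (cosets_of_weight C 1) = (q - 1)\<^sup>2"
    using card_weight_1_cosets assms(1) C by simp
  moreover have "\<forall>V\<in>cosets_of_weight C 1. distr_D1 C V"
    unfolding C cosets_of_weight_eq using distr_D1_coset by blast
  moreover have "\<forall>V\<in>cosets_of_weight C 3. distr_D3 C V"
    unfolding C cosets_of_weight_eq using distr_D3_coset by blast
  moreover have "(-1) ^ n * num_weight Va w - num_weight Va (n + 2 - w)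
      = (-1) ^ n * num_weight Vb w - num_weight Vb (n + 2 - w)"
    if "Va \<in> D2_class C i" "Vb \<in> D2_class C j" "w \<in> {3..n}" for i j Va Vb w
    using D2_class_difference[OF that(1) _ n] D2_class_difference[OF that(2) _ n] that(3) n by simp
  ultimately show ?thesis
    using weight_2_3_cosets_odd[OF _ assms(1)] weight_2_3_cosets_even[OF _ assms(1)] unfolding C[symmetric] assms(1)[symmetric]
    by blast
qed

end
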